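(* Let $\mathbb{K}$ be a field of characteristic zero, $\alpha\in\mathbb{K}^\times$, $J=(-4,4)$ and $A_\alpha=H^0\big(\mathcal{O}^q_\alpha(J)\big)$ with product $\star$. The assignment $\mathbf{q}\mapsto[\delta_0]$, $\mathbf{p}\mapsto\frac12[\delta_1-\delta_{-1}]$ defines an isomorphism of unital associative $\mathbf{K}$-algebras $$\mathbf{K}\langle\mathbf{q},\mathbf{p}\rangle/(\mathbf{p}\mathbf{q}-\mathbf{q}\mathbf{p}=\hbar)\;\longrightarrow\;(A_\alpha,\star).$$
   Context: For a set $S$, $\mathrm{Map}(S,\mathbb{K})$ is the vector space of functions $S\to\mathbb{K}$; for $S\subset T$, functions on $S$ are identified with functions on $T$ supported in $S$ (extension by $0$). $\delta_x$ denotes the function equal to $1$ at $x$ and $0$ elsewhere. Cochain complexes have differential of degree $+1$. Scalars: either $\hbar\in\mathbb{K}^\times$ and $\mathbf{K}=\mathbb{K}$, or $\hbar$ is a formal parameter and $\mathbf{K}=\mathbb{K}[\hbar]$ or $\mathbb{K}[\![\hbar]\!]$. Scalars are extended to $\mathbf{K}$ throughout. The operator $Q_\alpha$ on $\mathrm{Map}(\mathbb{Z},\mathbb{K})$ is $(Q_\alpha h)(x)=h(x-1)-(\alpha+\alpha^{-1})h(x)+h(x+1)$. For $a<b$ real, $\mathbb{V}_\alpha(a,b)$ is the cone of $Q_\alpha:\mathrm{Map}(\mathbb{Z}\cap(a+1,b-1),\mathbb{K})\to\mathrm{Map}(\mathbb{Z}\cap(a,b),\mathbb{K})$, i.e. the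 two-term complex with source in degree $-1$, target in degree $0$. An element $g$ of the source, seen in degree $-1$, is written $\overline{g}$, so the differential is $d\overline{g}=Q_\alpha g$. Thus $\mathrm{Sym}(\mathbb{V}_\alpha(a,b))$ is the free graded commutative algebra on degree $0$ generators $\delta_x$ ($x\in\mathbb{Z}\cap(a,b)$) and degree $-1$ generators $\overline{\delta}_x$ ($x\in\mathbb{Z}\cap(a+1,b-1)$); $d$ is extended by the Leibniz rule. Put $\Delta=\sum_x\frac{\partial^2}{\partial\overline{\delta}_x\partial\delta_x}$ (sum over integers $x\in(a+1,b-1)$), $d_\hbar=d+\hbar\Delta$, and $\mathcal{O}^q_\alpha(a,b)=(\mathrm{Sym}(\mathbb{V}_\alpha(a,b)),d_\hbar)$. Write $[\,\cdot\,]$ for classes in $H^0$. For intervals of length greater than $2$, inclusions $I\subset J$ induce quasi-isomorphisms $\mathcal{O}^q_\alpha(I)\to\mathcal{O}^q_\alpha(J)$, and for disjoint $I_1,I_2\subset J$ multiplication is a chain map $\mathcal{O}^q_\alpha(I_1)\otimes\mathcal{O}^q_\alpha(I_2)\to\mathcal{O}^q_\alpha(J)$ (the factorization product). The product $\star$ on $A_\alpha$ is the composition $A_\alpha\otimes A_\alpha\cong H^0(\mathcal{O}^q_\alpha(I_1))\otimes H^0(\mathcal{O}^q_\alpha(I_2))\to H^0(\mathcal{O}^q_\alpha(J))=A_\alpha$ of the inverses of the isomorphisms induced by the inclusions with the factorization product, for any disjoint open intervals $I_1,I_2\subset J$ of length greater than $2$ with $I_1$ to the left of $I_2$ (it does not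 depend on this choice). *)

theory Defs
  imports
    "HOL-Algebra.QuotRing"
    "HOL-Algebra.Module"
    "HOL-Algebra.Algebraic_Closure_Type"
    "HOL-Computational_Algebra.Formal_Power_Series"
    "HOL-Library.Poly_Mapping"
begin

section \<open>Unital associative algebras\<close>

text \<open>The library locale \<^locale>\<open>algebra\<close> is restricted to commutative algebras. The record type
  is shared with it.\<close>

locale unital_algebra = module + ring M +
  assumes smult_mult_left:
      "\<lbrakk>a \<in> carrier R; x \<in> carrier M; y \<in> carrier M\<rbrakk> \<Longrightarrow>
        (a \<odot>\<^bsub>M\<^esub> x) \<otimes>\<^bsub>M\<^esub> y = a \<odot>\<^bsub>M\<^esub> (x \<otimes>\<^bsub>M\<^esub> y)"
    and smult_mult_right:
      "\<lbrakk>a \<in> carrier R; x \<in> carrier M; y \<in> carrier M\<rbrakk> \<Longrightarrow>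
        x \<otimes>\<^bsub>M\<^esub> (a \<odot>\<^bsub>M\<^esub> y) = a \<odot>\<^bsub>M\<^esub> (x \<otimes>\<^bsub>M\<^esub> y)"

definition alg_hom :: "('r, 'x) ring_scheme \<Rightarrow> ('r, 'a) module \<Rightarrow> ('r, 'b) module \<Rightarrow> ('a \<Rightarrow> 'b) set"
  where "alg_hom R A B =
    {f \<in> ring_hom A B. \<forall>c\<in>carrier R. \<forall>x\<in>carrier A. f (c \<odot>\<^bsub>A\<^esub> x) = c \<odot>\<^bsub>B\<^esub> f x}"

definition alg_iso :: "('r, 'x) ring_scheme \<Rightarrow> ('r, 'a) module \<Rightarrow> ('r, 'b) module \<Rightarrow> ('a \<Rightarrow> 'b) set"
  where "alg_iso R A B = {f \<in> alg_hom R A B. bij_betw f (carrier A) (carrier B)}"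

text \<open>The assignment with graph \<open>ps\<close> extends to exactly one algebra homomorphism on the carrier
  of \<open>A\<close>, and this homomorphism is an isomorphism.\<close>

definition defines_alg_iso ::
    "('r, 'x) ring_scheme \<Rightarrow> ('r, 'a) module \<Rightarrow> ('r, 'b) module \<Rightarrow> ('a \<times> 'b) set \<Rightarrow> bool"
  where "defines_alg_iso R A B ps \<longleftrightarrow>
    unital_algebra R A \<and> unital_algebra R B \<and>
    (\<exists>f\<in>alg_iso R A B. (\<forall>(x, y)\<in>ps. f x = y) \<and>
      (\<forall>g\<in>alg_hom R A B. (\<forall>(x, y)\<in>ps. g x = y) \<longrightarrow> (\<forall>x\<in>carrier A. g x = f x)))"


section \<open>The algebra with generators \<open>q\<close>, \<open>p\<close> and relation \<open>pq - qp = hbar\<close>\<close>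

datatype weyl_gen = Gen_q | Gen_p

datatype weyl_word = Word "weyl_gen list"

instantiation weyl_word :: monoid_add
begin

definition zero_weyl_word :: weyl_word where "0 = Word []"

fun plus_weyl_word :: "weyl_word \<Rightarrow> weyl_word \<Rightarrow> weyl_word"
  where "Word u + Word v = Word (u @ v)"

instance
proof
  fix a b c :: weyl_word
  show "a + b + c = a + (b + c)"
    by (cases a; cases b; cases c) simp
  show "0 + a = a" "a + 0 = a"
    by (cases a; simp add: zero_weyl_word_def)+
qed

end

text \<open>Words are written additively, so that the monoid ring structure of \<^typ>\<open>weyl_word \<Rightarrow>\<^sub>0 'r\<close>
  makes it the free associative algebra on the two generators.\<close>

type_synonym 'r free_alg = "weyl_word \<Rightarrow>\<^sub>0 'r"

abbreviation free_gen :: "weyl_gen \<Rightarrow> ('r::comm_ring_1) free_alg"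
  where "free_gen g \<equiv> Poly_Mapping.single (Word [g]) 1"

abbreviation free_const :: "'r::comm_ring_1 \<Rightarrow> 'r free_alg"
  where "free_const c \<equiv> Poly_Mapping.single 0 c"

definition weyl_ideal :: "'r::comm_ring_1 \<Rightarrow> 'r free_alg set"
  where "weyl_ideal hbar = genideal ring_of_type_algebra
    {free_gen Gen_p * free_gen Gen_q - free_gen Gen_q * free_gen Gen_p - free_const hbar}"

definition weyl_class :: "'r::comm_ring_1 \<Rightarrow> 'r free_alg \<Rightarrow> 'r free_alg set"
  where "weyl_class hbar x = weyl_ideal hbar +>\<^bsub>ring_of_type_algebra\<^esub> x"

definition weyl_algebra :: "'r::comm_ring_1 \<Rightarrow> ('r, 'r free_alg set) module"
  where "weyl_algebra hbar =
    ring.extend (ring_of_type_algebra Quot weyl_ideal hbar)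
      (module.fields (\<lambda>c C. \<Union>x\<in>C. weyl_class hbar (free_const c * x)))"


section \<open>The complex of observables on an interval\<close>

text \<open>A pair \<open>(a, b)\<close> stands for the open interval from \<open>a\<close> to \<open>b\<close>.\<close>

type_synonym interval = "real \<times> real"

definition points :: "interval \<Rightarrow> int set"
  where "points I = {x. fst I < of_int x \<and> of_int x < snd I}"

definition inner_points :: "interval \<Rightarrow> int set"
  where "inner_points I = points (fst I + 1, snd I - 1)"

definition delta :: "int \<Rightarrow> int \<Rightarrow> 'k::zero_neq_one"
  where "delta x = (\<lambda>y. if y = x then 1 else 0)"

definition Q_op :: "'k::field \<Rightarrow> (int \<Rightarrow> 'k) \<Rightarrow> int \<Rightarrow> 'k"
  where "Q_op \<alpha> h = (\<lambda>x. h (x - 1) - (\<alpha> + inverse \<alpha>) * h x + h (x + 1))"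

text \<open>Polynomials in the commuting variables \<open>\<delta>\<^sub>x\<close>.\<close>

type_synonym 'r evpoly = "(int \<Rightarrow>\<^sub>0 nat) \<Rightarrow>\<^sub>0 'r"

abbreviation ev_var :: "int \<Rightarrow> ('r::comm_ring_1) evpoly"
  where "ev_var x \<equiv> Poly_Mapping.single (Poly_Mapping.single x 1) 1"

abbreviation ev_const :: "'r::comm_ring_1 \<Rightarrow> 'r evpoly"
  where "ev_const c \<equiv> Poly_Mapping.single 0 c"

definition ev_diff :: "int \<Rightarrow> ('r::comm_ring_1) evpoly \<Rightarrow> 'r evpoly"
  where "ev_diff x f = (\<Sum>m\<in>Poly_Mapping.keys f.
    Poly_Mapping.single (m - Poly_Mapping.single x 1)
      (of_nat (Poly_Mapping.lookup m x) * Poly_Mapping.lookup f m))"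

text \<open>A function on the integers with finite support as a linear polynomial. Here and below
  \<open>\<iota>\<close> is the structure map from the field to the ring of scalars, in which \<open>hbar\<close> lives.\<close>

definition ev_linear :: "('k::field \<Rightarrow> 'r::comm_ring_1) \<Rightarrow> interval \<Rightarrow> (int \<Rightarrow> 'k) \<Rightarrow> 'r evpoly"
  where "ev_linear \<iota> I h = (\<Sum>x\<in>points I. ev_const (\<iota> (h x)) * ev_var x)"

text \<open>The free graded commutative algebra is the tensor product of the polynomial ring in the
  \<open>\<delta>\<^sub>x\<close> with the exterior algebra on the odd generators. The value \<open>F S\<close> is the coefficient in
  \<open>F\<close> of the product of the odd generators with index in \<open>S\<close>, taken in increasing order.\<close>

type_synonym 'r sym = "int set \<Rightarrow> 'r evpoly"

definition sym_alg :: "interval \<Rightarrow> ('r::comm_ring_1) sym set"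
  where "sym_alg I = {F. \<forall>S. (F S \<noteq> 0 \<longrightarrow> S \<subseteq> inner_points I) \<and>
    (\<forall>m\<in>Poly_Mapping.keys (F S). Poly_Mapping.keys m \<subseteq> points I)}"

definition sym_deg :: "interval \<Rightarrow> int \<Rightarrow> ('r::comm_ring_1) sym set"
  where "sym_deg I n = {F \<in> sym_alg I. \<forall>S. F S \<noteq> 0 \<longrightarrow> int (card S) = - n}"

definition sym_zero :: "('r::comm_ring_1) sym"
  where "sym_zero = (\<lambda>S. 0)"

definition sym_add :: "('r::comm_ring_1) sym \<Rightarrow> 'r sym \<Rightarrow> 'r sym"
  where "sym_add F G = (\<lambda>S. F S + G S)"

definition sym_smult :: "'r::comm_ring_1 \<Rightarrow> 'r sym \<Rightarrow> 'r sym"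
  where "sym_smult c F = (\<lambda>S. ev_const c * F S)"

definition sym_even :: "('r::comm_ring_1) evpoly \<Rightarrow> 'r sym"
  where "sym_even f = (\<lambda>S. if S = {} then f else 0)"

definition sym_odd :: "int \<Rightarrow> ('r::comm_ring_1) sym"
  where "sym_odd x = (\<lambda>S. if S = {x} then 1 else 0)"

text \<open>The sign of the permutation sorting the concatenation of two increasing sequences.\<close>

definition koszul_sign :: "int set \<Rightarrow> int set \<Rightarrow> 'r::comm_ring_1"
  where "koszul_sign S T = (- 1) ^ card {(s, t). s \<in> S \<and> t \<in> T \<and> t < s}"

definition sym_mult :: "('r::comm_ring_1) sym \<Rightarrow> 'r sym \<Rightarrow> 'r sym"
  where "sym_mult F G = (\<lambda>U. \<Sum>S\<in>Pow U. koszul_sign S (U - S) * F S * G (U - S))"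

text \<open>The odd (left) derivative in the direction of the odd generator with index \<open>x\<close>.\<close>

definition odd_diff :: "int \<Rightarrow> ('r::comm_ring_1) sym \<Rightarrow> 'r sym"
  where "odd_diff x F =
    (\<lambda>U. if x \<in> U then 0 else (- 1) ^ card {t \<in> U. t < x} * F (insert x U))"

text \<open>A derivation of degree 1 is determined by its values on generators; this is the one that
  vanishes on the \<open>\<delta>\<^sub>x\<close> and sends the odd generator with index \<open>x\<close> to \<open>Q\<^sub>\<alpha> \<delta>\<^sub>x\<close>,
  see \<open>sym_d_leibniz\<close>, \<open>sym_d_even\<close> and \<open>sym_d_odd\<close> below.\<close>

definition sym_d :: "('k::field \<Rightarrow> 'r::comm_ring_1) \<Rightarrow> 'k \<Rightarrow> interval \<Rightarrow> 'r sym \<Rightarrow> 'r sym"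
  where "sym_d \<iota> \<alpha> I F =
    (\<lambda>U. \<Sum>x\<in>inner_points I. ev_linear \<iota> I (Q_op \<alpha> (delta x)) * odd_diff x F U)"

definition sym_Delta :: "interval \<Rightarrow> ('r::comm_ring_1) sym \<Rightarrow> 'r sym"
  where "sym_Delta I F =
    (\<lambda>U. \<Sum>x\<in>inner_points I. odd_diff x (\<lambda>S. ev_diff x (F S)) U)"

definition sym_dh ::
    "('k::field \<Rightarrow> 'r::comm_ring_1) \<Rightarrow> 'k \<Rightarrow> 'r \<Rightarrow> interval \<Rightarrow> 'r sym \<Rightarrow> 'r sym"
  where "sym_dh \<iota> \<alpha> hbar I F =
    sym_add (sym_d \<iota> \<alpha> I F) (sym_smult hbar (sym_Delta I F))"


lemma sym_d_even: "sym_d \<iota> \<alpha> I (sym_even f) = sym_zero"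
  by (simp add: sym_d_def sym_even_def sym_zero_def odd_diff_def if_distrib cong: if_cong)

lemma finite_points: "finite (points I)"
proof (rule finite_subset)
  show "points I \<subseteq> {\<lfloor>fst I\<rfloor>..\<lceil>snd I\<rceil>}"
    by (auto simp: points_def) linarith+
qed simp

lemma sym_d_odd:
  assumes "x \<in> inner_points I"
  shows "sym_d \<iota> \<alpha> I (sym_odd x) = sym_even (ev_linear \<iota> I (Q_op \<alpha> (delta x)))"
proof
  fix U :: "int set"
  let ?q = "\<lambda>y. ev_linear \<iota> I (Q_op \<alpha> (delta y))"
  have *: "odd_diff y (sym_odd x) U = (if y = x then if U = {} then 1 else 0 else 0)" for y
    by (auto simp: odd_diff_def sym_odd_def)
  have "finite (inner_points I)"
    by (simp add: inner_points_def finite_points)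
  then show "sym_d \<iota> \<alpha> I (sym_odd x) U = sym_even (?q x) U"
    using assms by (simp add: sym_d_def * sym_even_def if_distrib sum.delta cong: if_cong)
qed

text \<open>Auxiliary sign computations for the graded Leibniz rule.\<close>

lemma koszul_sign_insert_left:
  assumes "finite S" "finite T" "x \<notin> S"
  shows "koszul_sign (insert x S) T = koszul_sign S T * (- 1) ^ card {t \<in> T. t < x}"
proof -
  have "{(s, t). s \<in> insert x S \<and> t \<in> T \<and> t < s} =
    {(s, t). s \<in> S \<and> t \<in> T \<and> t < s} \<union> Pair x ` {t \<in> T. t < x}" by auto
  moreover have "finite {(s, t). s \<in> S \<and> t \<in> T \<and> t < s}"
    by (rule finite_subset[of _ "S \<times> T"]) (use assms in auto)
  moreover have "{(s, t). s \<in> S \<and> t \<in> T \<and> t < s} \<inter> Pair x ` {t \<in> T. t < x} = {}"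
    using assms(3) by auto
  moreover have "card (Pair x ` {t \<in> T. t < x}) = card {t \<in> T. t < x}"
    by (rule card_image) (simp add: inj_on_def)
  ultimately show ?thesis
    using assms(2) by (simp add: koszul_sign_def card_Un_disjoint power_add)
qed

lemma koszul_sign_insert_right:
  assumes "finite S" "finite T" "x \<notin> T"
  shows "koszul_sign S (insert x T) = koszul_sign S T * (- 1) ^ card {s \<in> S. x < s}"
proof -
  have "{(s, t). s \<in> S \<and> t \<in> insert x T \<and> t < s} =
    {(s, t). s \<in> S \<and> t \<in> T \<and> t < s} \<union> (\<lambda>s. (s, x)) ` {s \<in> S. x < s}" by auto
  moreover have "finite {(s, t). s \<in> S \<and> t \<in> T \<and> t < s}"
    by (rule finite_subset[of _ "S \<times> T"]) (use assms in auto)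
  moreover have "{(s, t). s \<in> S \<and> t \<in> T \<and> t < s} \<inter> (\<lambda>s. (s, x)) ` {s \<in> S. x < s} = {}"
    using assms(3) by auto
  moreover have "card ((\<lambda>s. (s, x)) ` {s \<in> S. x < s}) = card {s \<in> S. x < s}"
    by (rule card_image) (simp add: inj_on_def)
  ultimately show ?thesis
    using assms(1) by (simp add: koszul_sign_def card_Un_disjoint power_add)
qed

lemma card_less_Un:
  assumes "finite S" "finite T" "S \<inter> T = {}"
  shows "card {t \<in> S \<union> T. t < (x::int)} = card {t \<in> S. t < x} + card {t \<in> T. t < x}"
proof -
  have "{t \<in> S \<union> T. t < x} = {t \<in> S. t < x} \<union> {t \<in> T. t < x}" by auto
  then show ?thesis using assms by (simp add: card_Un_disjoint disjoint_iff)
qed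

lemma card_split:
  assumes "finite S" "(x::int) \<notin> S"
  shows "card S = card {s \<in> S. s < x} + card {s \<in> S. x < s}"
proof -
  have "S = {s \<in> S. s < x} \<union> {s \<in> S. x < s}" using assms(2) by (auto simp: neq_iff) (metis neq_iff)
  then have "card S = card ({s \<in> S. s < x} \<union> {s \<in> S. x < s})" by simp
  then show ?thesis using assms(1) by (subst (asm) card_Un_disjoint) auto
qed

lemma neg_one_square_cancel: "(- 1) ^ n * ((- 1) ^ n * (a::'a::comm_ring_1)) = a"
  by (simp flip: mult.assoc power_mult_distrib)

lemma Pow_insert_sum:
  assumes "finite U" "x \<notin> U"
  shows "(\<Sum>S\<in>Pow (insert x U). f S) =
    (\<Sum>S\<in>Pow U. f (insert x S)) + (\<Sum>S\<in>Pow U. (f S :: 'a::comm_monoid_add))"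
proof -
  have "inj_on (insert x) (Pow U)" using assms(2) by (auto simp: inj_on_def)
  moreover have "Pow U \<inter> insert x ` Pow U = {}" using assms(2) by auto
  ultimately show ?thesis
    using assms(1) by (simp add: Pow_insert sum.union_disjoint sum.reindex add.commute)
qed

lemma odd_diff_mult:
  assumes "finite U"
  shows "odd_diff x (sym_mult F G) U =
    sym_mult (odd_diff x F) G U + sym_mult (\<lambda>S. (- 1) ^ card S * F S) (odd_diff x G) U"
proof (cases "x \<in> U")
  case False
  have 1: "(- 1) ^ card {t \<in> U. t < x} *
        (koszul_sign (insert x S) (insert x U - insert x S) * F (insert x S) * G (insert x U - insert x S))
      = koszul_sign S (U - S) * odd_diff x F S * G (U - S)" if "S \<in> Pow U" for S
  proof -
    have fin: "finite S" "finite (U - S)" "x \<notin> S" "x \<notin> U - S" and U: "U = S \<union> (U - S)"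
      using that assms False finite_subset by auto
    have "insert x U - insert x S = U - S" using fin by auto
    moreover have "card {t \<in> U. t < x} = card {t \<in> S. t < x} + card {t \<in> U - S. t < x}"
      by (subst U, rule card_less_Un) (use fin in auto)
    ultimately show ?thesis
      using fin by (simp add: odd_diff_def koszul_sign_insert_left power_add neg_one_square_cancel mult_ac)
  qed
  have 2: "(- 1) ^ card {t \<in> U. t < x} *
        (koszul_sign S (insert x U - S) * F S * G (insert x U - S))
      = koszul_sign S (U - S) * ((- 1) ^ card S * F S) * odd_diff x G (U - S)" if "S \<in> Pow U" for S
  proof -
    have fin: "finite S" "finite (U - S)" "x \<notin> S" "x \<notin> U - S" and U: "U = S \<union> (U - S)"
      using that assms False finite_subset by auto
    have "insert x U - S = insert x (U - S)" using fin by auto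
    moreover have "card {t \<in> U. t < x} = card {t \<in> S. t < x} + card {t \<in> U - S. t < x}"
      by (subst U, rule card_less_Un) (use fin in auto)
    moreover have "card S = card {s \<in> S. s < x} + card {s \<in> S. x < s}"
      using fin by (intro card_split)
    ultimately show ?thesis
      using fin by (simp add: odd_diff_def koszul_sign_insert_right power_add mult_ac)
  qed
  have "odd_diff x (sym_mult F G) U =
    (\<Sum>S\<in>Pow U. (- 1) ^ card {t \<in> U. t < x} *
        (koszul_sign (insert x S) (insert x U - insert x S) * F (insert x S) * G (insert x U - insert x S))) +
    (\<Sum>S\<in>Pow U. (- 1) ^ card {t \<in> U. t < x} *
        (koszul_sign S (insert x U - S) * F S * G (insert x U - S)))"
    using False by (simp add: odd_diff_def sym_mult_def Pow_insert_sum[OF assms] distrib_left sum_distrib_left)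
  then show ?thesis
    using 1 2 unfolding sym_mult_def by (simp only: sum.cong[OF refl 1] sum.cong[OF refl 2])
next
  case True
  define V where "V = U - {x}"
  have U: "U = insert x V" and V: "finite V" "x \<notin> V" using True assms by (auto simp: V_def)
  have 1: "koszul_sign S (U - S) * odd_diff x F S * G (U - S) +
      koszul_sign (insert x S) (U - insert x S) * ((- 1) ^ card (insert x S) * F (insert x S)) *
        odd_diff x G (U - insert x S) = 0" if "S \<in> Pow V" for S
  proof -
    have fin: "finite S" "finite (V - S)" "x \<notin> S" "x \<notin> V - S"
      using that V finite_subset by auto
    have e: "U - S = insert x (V - S)" "U - insert x S = V - S" using fin that by (auto simp: U)
    have c: "card S = card {s \<in> S. s < x} + card {s \<in> S. x < s}"
      using fin by (intro card_split)
    have s1: "koszul_sign S (U - S) * (- 1) ^ card {t \<in> S. t < x} = koszul_sign S (V - S) * (- 1) ^ card S"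
      unfolding e using fin by (simp add: koszul_sign_insert_right c power_add mult_ac)
    have s2: "koszul_sign (insert x S) (U - insert x S) * (- 1) ^ card (insert x S) *
        (- 1) ^ card {t \<in> V - S. t < x} = - (koszul_sign S (V - S) * (- 1) ^ card S)"
      unfolding e using fin by (simp add: koszul_sign_insert_left neg_one_square_cancel mult_ac)
    have "koszul_sign S (U - S) * odd_diff x F S * G (U - S) =
      (koszul_sign S (U - S) * (- 1) ^ card {t \<in> S. t < x}) * F (insert x S) * G (insert x (V - S))"
      using fin by (simp add: odd_diff_def e mult_ac)
    moreover have "koszul_sign (insert x S) (U - insert x S) * ((- 1) ^ card (insert x S) * F (insert x S)) *
        odd_diff x G (U - insert x S) =
      (koszul_sign (insert x S) (U - insert x S) * (- 1) ^ card (insert x S) *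
        (- 1) ^ card {t \<in> V - S. t < x}) * F (insert x S) * G (insert x (V - S))"
      using fin by (simp add: odd_diff_def e mult_ac)
    ultimately show ?thesis unfolding s1 s2 by (simp add: algebra_simps)
  qed
  have 2: "koszul_sign (insert x S) (U - insert x S) * odd_diff x F (insert x S) * G (U - insert x S) = 0" for S
    by (simp add: odd_diff_def)
  have 3: "koszul_sign S (U - S) * ((- 1) ^ card S * F S) * odd_diff x G (U - S) = 0"
    if "S \<in> Pow V" for S
    using that V by (auto simp: odd_diff_def U)
  have "sym_mult (odd_diff x F) G U + sym_mult (\<lambda>S. (- 1) ^ card S * F S) (odd_diff x G) U =
    (\<Sum>S\<in>Pow V. koszul_sign S (U - S) * odd_diff x F S * G (U - S)) +
    (\<Sum>S\<in>Pow V. koszul_sign (insert x S) (U - insert x S) * ((- 1) ^ card (insert x S) * F (insert x S)) *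
        odd_diff x G (U - insert x S))"
  proof -
    have "(\<Sum>S\<in>Pow V. koszul_sign S (U - S) * ((- 1) ^ card S * F S) * odd_diff x G (U - S)) = 0"
      by (intro sum.neutral ballI 3)
    moreover have "Pow U = Pow (insert x V)" using U by simp
    ultimately show ?thesis
      unfolding sym_mult_def by (simp add: Pow_insert_sum[OF V] 2 del: Pow_insert)
  qed
  also have "\<dots> = 0" using 1 by (simp flip: sum.distrib)
  finally show ?thesis using True by (simp add: odd_diff_def)
qed

text \<open>Coefficients at infinite sets of odd generators vanish for all elements of \<^const>\<open>sym_alg\<close>,
  so finiteness of \<open>U\<close> is no restriction.\<close>

lemma sym_d_leibniz:
  assumes "F \<in> sym_deg I n" "finite U"
  shows "sym_d \<iota> \<alpha> I (sym_mult F G) U =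
    sym_mult (sym_d \<iota> \<alpha> I F) G U + (- 1) ^ nat (- n) * sym_mult F (sym_d \<iota> \<alpha> I G) U"
proof -
  have F: "(\<lambda>S. (- 1) ^ card S * F S) = (\<lambda>S. (- 1) ^ nat (- n) * F S)"
  proof
    fix S
    show "(- 1) ^ card S * F S = (- 1) ^ nat (- n) * F S"
    proof (cases "F S = 0")
      case False
      then have "int (card S) = - n" using assms(1) by (simp add: sym_deg_def)
      then have "card S = nat (- n)" by simp
      then show ?thesis by simp
    qed simp
  qed
  let ?q = "\<lambda>y. ev_linear \<iota> I (Q_op \<alpha> (delta y))"
  have "sym_d \<iota> \<alpha> I (sym_mult F G) U =
    (\<Sum>x\<in>inner_points I. ?q x * sym_mult (odd_diff x F) G U) +
    (\<Sum>x\<in>inner_points I. ?q x * sym_mult (\<lambda>S. (- 1) ^ nat (- n) * F S) (odd_diff x G) U)"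
    using assms(2) by (simp add: sym_d_def odd_diff_mult F distrib_left sum.distrib)
  also have "(\<Sum>x\<in>inner_points I. ?q x * sym_mult (odd_diff x F) G U) = sym_mult (sym_d \<iota> \<alpha> I F) G U"
    unfolding sym_mult_def sym_d_def sum_distrib_left sum_distrib_right
    by (subst sum.swap) (simp add: mult_ac)
  also have "(\<Sum>x\<in>inner_points I. ?q x * sym_mult (\<lambda>S. (- 1) ^ nat (- n) * F S) (odd_diff x G) U)
    = (- 1) ^ nat (- n) * sym_mult F (sym_d \<iota> \<alpha> I G) U"
    unfolding sym_mult_def sym_d_def sum_distrib_left sum_distrib_right
    by (subst sum.swap) (simp add: mult_ac)
  finally show ?thesis .
qed


subsection \<open>Cohomology\<close>

definition cocycles ::
    "('k::field \<Rightarrow> 'r::comm_ring_1) \<Rightarrow> 'k \<Rightarrow> 'r \<Rightarrow> interval \<Rightarrow> int \<Rightarrow> 'r sym set"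
  where "cocycles \<iota> \<alpha> hbar I n = {F \<in> sym_deg I n. sym_dh \<iota> \<alpha> hbar I F = sym_zero}"

definition coboundaries ::
    "('k::field \<Rightarrow> 'r::comm_ring_1) \<Rightarrow> 'k \<Rightarrow> 'r \<Rightarrow> interval \<Rightarrow> int \<Rightarrow> 'r sym set"
  where "coboundaries \<iota> \<alpha> hbar I n = sym_dh \<iota> \<alpha> hbar I ` sym_deg I (n - 1)"

definition H0_class ::
    "('k::field \<Rightarrow> 'r::comm_ring_1) \<Rightarrow> 'k \<Rightarrow> 'r \<Rightarrow> interval \<Rightarrow> 'r sym \<Rightarrow> 'r sym set"
  where "H0_class \<iota> \<alpha> hbar I F = sym_add F ` coboundaries \<iota> \<alpha> hbar I 0"

definition H0 ::
    "('k::field \<Rightarrow> 'r::comm_ring_1) \<Rightarrow> 'k \<Rightarrow> 'r \<Rightarrow> interval \<Rightarrow> 'r sym set set"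
  where "H0 \<iota> \<alpha> hbar I = H0_class \<iota> \<alpha> hbar I ` cocycles \<iota> \<alpha> hbar I 0"

text \<open>Whenever \<open>I\<close> is contained in \<open>J\<close>, \<^term>\<open>sym_alg I\<close> is literally a subset of \<^term>\<open>sym_alg J\<close>. As in
  \<^const>\<open>rcoset_mult\<close>, operations on classes are unions over representatives.\<close>

definition H0_incl ::
    "('k::field \<Rightarrow> 'r::comm_ring_1) \<Rightarrow> 'k \<Rightarrow> 'r \<Rightarrow> interval \<Rightarrow> 'r sym set \<Rightarrow> 'r sym set"
  where "H0_incl \<iota> \<alpha> hbar J C = (\<Union>F\<in>C. H0_class \<iota> \<alpha> hbar J F)"

definition fact_product ::
    "('k::field \<Rightarrow> 'r::comm_ring_1) \<Rightarrow> 'k \<Rightarrow> 'r \<Rightarrow> interval \<Rightarrow>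
      'r sym set \<Rightarrow> 'r sym set \<Rightarrow> 'r sym set"
  where "fact_product \<iota> \<alpha> hbar J C D =
    (\<Union>F\<in>C. \<Union>G\<in>D. H0_class \<iota> \<alpha> hbar J (sym_mult F G))"

definition star ::
    "('k::field \<Rightarrow> 'r::comm_ring_1) \<Rightarrow> 'k \<Rightarrow> 'r \<Rightarrow> interval \<Rightarrow> interval \<Rightarrow> interval \<Rightarrow>
      'r sym set \<Rightarrow> 'r sym set \<Rightarrow> 'r sym set"
  where "star \<iota> \<alpha> hbar I\<^sub>1 I\<^sub>2 J C D = fact_product \<iota> \<alpha> hbar J
    (inv_into (H0 \<iota> \<alpha> hbar I\<^sub>1) (H0_incl \<iota> \<alpha> hbar J) C)
    (inv_into (H0 \<iota> \<alpha> hbar I\<^sub>2) (H0_incl \<iota> \<alpha> hbar J) D)"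

definition obs_algebra ::
    "('k::field \<Rightarrow> 'r::comm_ring_1) \<Rightarrow> 'k \<Rightarrow> 'r \<Rightarrow> interval \<Rightarrow> interval \<Rightarrow> interval \<Rightarrow>
      ('r, 'r sym set) module"
  where "obs_algebra \<iota> \<alpha> hbar I\<^sub>1 I\<^sub>2 J =
    \<lparr>carrier = H0 \<iota> \<alpha> hbar J,
     monoid.mult = star \<iota> \<alpha> hbar I\<^sub>1 I\<^sub>2 J,
     one = H0_class \<iota> \<alpha> hbar J (sym_even 1),
     ring.zero = H0_class \<iota> \<alpha> hbar J sym_zero,
     add = (\<lambda>C D. \<Union>F\<in>C. \<Union>G\<in>D. H0_class \<iota> \<alpha> hbar J (sym_add F G)),
     module.smult = (\<lambda>c C. \<Union>F\<in>C. H0_class \<iota> \<alpha> hbar J (sym_smult c F))\<rparr>"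

text \<open>The class \<open>[h]\<close> of a function \<open>h\<close> supported in the interval.\<close>

definition H0_fun ::
    "('k::field \<Rightarrow> 'r::comm_ring_1) \<Rightarrow> 'k \<Rightarrow> 'r \<Rightarrow> interval \<Rightarrow> (int \<Rightarrow> 'k) \<Rightarrow> 'r sym set"
  where "H0_fun \<iota> \<alpha> hbar J h = H0_class \<iota> \<alpha> hbar J (sym_even (ev_linear \<iota> J h))"

end

theory Submission
  imports Defs
begin

text \<open>Write \<open>c = \<iota> (\<alpha> + inverse \<alpha>)\<close>. In the Weyl algebra let \<open>X\<^sub>x\<close> (\<open>mode x\<close> below) be the solution of
  \<open>X\<^bsub>x-1\<^esub> - c X\<^sub>x + X\<^bsub>x+1\<^esub> = 0\<close> with \<open>X\<^sub>0 = q\<close> and \<open>X\<^sub>1 - X\<^bsub>-1\<^esub> = 2 p\<close>; then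
  \<open>X\<^bsub>x+1\<^esub> X\<^sub>x - X\<^sub>x X\<^bsub>x+1\<^esub> = hbar\<close> for all \<open>x\<close>. Sending a monomial in the \<open>\<delta>\<^sub>x\<close> to the product of the
  corresponding \<open>X\<^sub>x\<close>, ordered by increasing \<open>x\<close>, kills the image of \<open>d\<^bsub>hbar\<^esub>\<close>, because commuting \<open>X\<^bsub>x+1\<^esub>\<close> past
  a power of \<open>X\<^sub>x\<close> reproduces the term \<open>hbar \<partial>/\<partial>\<delta>\<^sub>x\<close>, and it turns the product of a polynomial on the
  left with one on the right into the product of the Weyl algebra. On an interval starting at \<open>m\<close> every
  polynomial is congruent modulo the image of \<open>d\<^bsub>hbar\<^esub>\<close> to one in \<open>\<delta>\<^sub>m\<close> and \<open>\<delta>\<^bsub>m+1\<^esub>\<close> alone, and the ordered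
  monomials in \<open>X\<^sub>m\<close> and \<open>X\<^bsub>m+1\<^esub>\<close> form a basis, as seen in a polynomial representation. So normal ordering
  identifies \<open>H\<^sup>0\<close> of every interval with the Weyl algebra, compatibly with all inclusions.\<close>


section \<open>Linear extension of maps on monomials\<close>

text \<open>Scalars act as left multiplication by constants \<open>Poly_Mapping.single 0 r\<close>,
  so one definition serves partial derivatives of commutative polynomials, normal ordering into the
  free algebra, and the action of the free algebra on polynomials.\<close>

definition lin_ext ::
    "('a \<Rightarrow> ('b::monoid_add \<Rightarrow>\<^sub>0 'r::comm_ring_1)) \<Rightarrow> ('a \<Rightarrow>\<^sub>0 'r) \<Rightarrow> ('b \<Rightarrow>\<^sub>0 'r)"
  where "lin_ext \<phi> f =
    (\<Sum>a\<in>Poly_Mapping.keys f. Poly_Mapping.single 0 (Poly_Mapping.lookup f a) * \<phi> a)"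

lemma poly_mapping_eq_sum_single:
  fixes f :: "'a \<Rightarrow>\<^sub>0 'b::comm_monoid_add"
  shows "f = (\<Sum>a\<in>Poly_Mapping.keys f. Poly_Mapping.single a (Poly_Mapping.lookup f a))"
proof (rule poly_mapping_eqI)
  fix k
  show "Poly_Mapping.lookup f k = Poly_Mapping.lookup
      (\<Sum>a\<in>Poly_Mapping.keys f. Poly_Mapping.single a (Poly_Mapping.lookup f a)) k"
    by (simp add: lookup_sum lookup_single when_def in_keys_iff)
qed

text \<open>Every such mapping is the finite sum of its monomials, so linear statements reduce to
  monomials with exponent in \<open>A\<close>.\<close>

lemma poly_mapping_span_induct [consumes 1, case_names zero single add]:
  fixes f :: "'a \<Rightarrow>\<^sub>0 'b::comm_monoid_add"
  assumes "Poly_Mapping.keys f \<subseteq> A"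
    and "P 0"
    and "\<And>a r. a \<in> A \<Longrightarrow> P (Poly_Mapping.single a r)"
    and "\<And>g h. P g \<Longrightarrow> P h \<Longrightarrow> P (g + h)"
  shows "P f"
proof -
  have "P (\<Sum>a\<in>K. Poly_Mapping.single a (Poly_Mapping.lookup f a))" if "finite K" "K \<subseteq> A" for K
    using that by (induction K rule: finite_induct) (auto intro: assms)
  then show ?thesis
    using assms(1) by (subst poly_mapping_eq_sum_single) simp
qed

lemma lin_ext_superset:
  assumes "finite A" "Poly_Mapping.keys f \<subseteq> A"
  shows "lin_ext \<phi> f = (\<Sum>a\<in>A. Poly_Mapping.single 0 (Poly_Mapping.lookup f a) * \<phi> a)"
  unfolding lin_ext_def
  by (rule sum.mono_neutral_left) (use assms in \<open>auto simp: in_keys_iff\<close>)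

lemma lin_ext_zero [simp]: "lin_ext \<phi> 0 = 0"
  by (simp add: lin_ext_def)

lemma lin_ext_single [simp]:
  "lin_ext \<phi> (Poly_Mapping.single a r) = Poly_Mapping.single 0 r * \<phi> a"
  by (simp add: lin_ext_superset[of "{a}"])

lemma lin_ext_add: "lin_ext \<phi> (f + g) = lin_ext \<phi> f + lin_ext \<phi> g"
proof -
  let ?A = "Poly_Mapping.keys f \<union> Poly_Mapping.keys g"
  have "Poly_Mapping.keys (f + g) \<subseteq> ?A" by (rule keys_add)
  then show ?thesis
    by (simp add: lin_ext_superset[of ?A] lookup_add single_add distrib_right sum.distrib)
qed

lemma lin_ext_diff: "lin_ext \<phi> (f - g) = lin_ext \<phi> f - lin_ext \<phi> g"
  using lin_ext_add[of \<phi> "f - g" g] by simp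

text \<open>Constants are central even over a noncommutative monoid, because 0 is neutral on both
  sides and coefficients commute.\<close>

lemma single_zero_commute:
  fixes f :: "'a::monoid_add \<Rightarrow>\<^sub>0 'r::comm_ring_1"
  shows "f * Poly_Mapping.single 0 r = Poly_Mapping.single 0 r * f"
proof -
  have "Poly_Mapping.keys f \<subseteq> UNIV" by simp
  then show ?thesis
    by (induction f rule: poly_mapping_span_induct)
      (auto simp: mult_single mult.commute distrib_left distrib_right)
qed

lemma single_zero_left_commute:
  fixes f g :: "'a::monoid_add \<Rightarrow>\<^sub>0 'r::comm_ring_1"
  shows "f * (Poly_Mapping.single 0 r * g) = Poly_Mapping.single 0 r * (f * g)"
  by (metis mult.assoc single_zero_commute)

lemma single_zero_mult:
  "Poly_Mapping.single 0 r * Poly_Mapping.single (0::'a::monoid_add) s =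
    Poly_Mapping.single 0 (r * s :: 'r::comm_ring_1)"
  by (simp add: mult_single)

lemma lin_ext_scale:
  "lin_ext \<phi> (Poly_Mapping.single 0 r * f) = Poly_Mapping.single 0 r * lin_ext \<phi> f"
proof -
  have "Poly_Mapping.keys f \<subseteq> UNIV" by simp
  then show ?thesis
  proof (induction f rule: poly_mapping_span_induct)
    case (single a s)
    then show ?case
      by (simp add: mult_single) (simp add: mult.assoc flip: single_zero_mult)
  qed (auto simp: distrib_left lin_ext_add)
qed

lemma lin_ext_fun_add: "lin_ext (\<lambda>a. \<phi> a + \<psi> a) f = lin_ext \<phi> f + lin_ext \<psi> f"
  by (simp add: lin_ext_def distrib_left sum.distrib)

lemma lin_ext_fun_scale:
  "lin_ext (\<lambda>a. Poly_Mapping.single 0 r * \<phi> a) f = Poly_Mapping.single 0 r * lin_ext \<phi> f"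
  unfolding lin_ext_def sum_distrib_left
  by (rule sum.cong[OF refl], rule single_zero_left_commute)


section \<open>Polynomials in the even generators\<close>

definition polys_in :: "int set \<Rightarrow> 'r::comm_ring_1 evpoly set"
  where "polys_in S = {f. \<forall>m\<in>Poly_Mapping.keys f. Poly_Mapping.keys m \<subseteq> S}"

lemma polys_in_induct [consumes 1, case_names zero single add]:
  assumes "f \<in> polys_in S"
    and "P 0"
    and "\<And>m r. Poly_Mapping.keys m \<subseteq> S \<Longrightarrow> P (Poly_Mapping.single m r)"
    and "\<And>g h. P g \<Longrightarrow> P h \<Longrightarrow> P (g + h)"
  shows "P f"
proof -
  have "Poly_Mapping.keys f \<subseteq> {m. Poly_Mapping.keys m \<subseteq> S}"
    using assms(1) by (auto simp: polys_in_def)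
  then show ?thesis
    by (rule poly_mapping_span_induct) (use assms(2-4) in blast)+
qed

lemma polys_in_zero [simp]: "0 \<in> polys_in S"
  and polys_in_one [simp]: "1 \<in> polys_in S"
  and polys_in_const [simp]: "ev_const r \<in> polys_in S"
  by (auto simp: polys_in_def)

lemma polys_in_var: "x \<in> S \<Longrightarrow> ev_var x \<in> polys_in S"
  by (auto simp: polys_in_def)

lemma polys_in_add: "f \<in> polys_in S \<Longrightarrow> g \<in> polys_in S \<Longrightarrow> f + g \<in> polys_in S"
  using keys_add[of f g] by (auto simp: polys_in_def)

lemma polys_in_uminus: "f \<in> polys_in S \<Longrightarrow> - f \<in> polys_in S"
  by (auto simp: polys_in_def in_keys_iff)

lemma polys_in_diff: "f \<in> polys_in S \<Longrightarrow> g \<in> polys_in S \<Longrightarrow> f - g \<in> polys_in S"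
  using polys_in_add[of f S "- g"] polys_in_uminus[of g S] by simp

lemma polys_in_mult:
  assumes "f \<in> polys_in S" "g \<in> polys_in S"
  shows "f * g \<in> polys_in S"
  unfolding polys_in_def
proof (intro CollectI ballI)
  fix m assume "m \<in> Poly_Mapping.keys (f * g)"
  then obtain a b where "m = a + b" "a \<in> Poly_Mapping.keys f" "b \<in> Poly_Mapping.keys g"
    using keys_mult[of f g] by blast
  then show "Poly_Mapping.keys m \<subseteq> S"
    using assms keys_add[of a b] unfolding polys_in_def by blast
qed

lemma polys_in_sum: "(\<And>x. x \<in> A \<Longrightarrow> f x \<in> polys_in S) \<Longrightarrow> (\<Sum>x\<in>A. f x) \<in> polys_in S"
  by (induction A rule: infinite_finite_induct) (auto intro: polys_in_add)

lemma polys_in_mono: "S \<subseteq> T \<Longrightarrow> f \<in> polys_in S \<Longrightarrow> f \<in> polys_in T"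
  by (auto simp: polys_in_def)

lemma ev_diff_eq_lin_ext:
  "ev_diff x = lin_ext (\<lambda>m. Poly_Mapping.single (m - Poly_Mapping.single x 1)
    (of_nat (Poly_Mapping.lookup m x) :: 'r::comm_ring_1))"
  by (rule ext) (simp add: ev_diff_def lin_ext_def mult_single mult.commute)

lemma ev_diff_zero [simp]: "ev_diff x 0 = 0"
  and ev_diff_add: "ev_diff x (f + g) = ev_diff x f + ev_diff x g"
  and ev_diff_diff: "ev_diff x (f - g) = ev_diff x f - ev_diff x g"
  and ev_diff_scale: "ev_diff x (ev_const r * f) = ev_const r * ev_diff x f"
  and ev_diff_single: "ev_diff x (Poly_Mapping.single m r) =
    Poly_Mapping.single (m - Poly_Mapping.single x 1) (of_nat (Poly_Mapping.lookup m x) * r)"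
  by (simp_all add: ev_diff_eq_lin_ext lin_ext_add lin_ext_diff lin_ext_scale mult_single
      mult.commute[of r])

lemma ev_diff_one [simp]: "ev_diff x 1 = 0"
  using ev_diff_single[of x 0 1] by simp

lemma ev_diff_var_mult:
  "ev_diff x (ev_var y * f) = (if x = y then f else 0) + ev_var y * ev_diff x f"
proof -
  have "Poly_Mapping.keys f \<subseteq> UNIV" by simp
  then show ?thesis
  proof (induction f rule: poly_mapping_span_induct)
    case (single m r)
    let ?s = "\<lambda>x. Poly_Mapping.single x (1::nat)"
    show ?case
    proof (cases "x = y")
      case True
      have "?s y + m - ?s y = m" by simp
      \<comment> \<open>Exponents are natural numbers, so lowering and raising cancel only for a
        positive exponent; at exponent 0 the coefficient \<open>of_nat 0\<close> removes the
        term.\<close>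
      moreover have "m = ?s y + (m - ?s y)" if "Poly_Mapping.lookup m y \<noteq> 0"
        by (rule poly_mapping_eqI)
          (use that in \<open>auto simp: lookup_add lookup_minus lookup_single when_def\<close>)
      ultimately show ?thesis
        using True by (cases "Poly_Mapping.lookup m y = 0")
          (simp_all add: mult_single ev_diff_single lookup_add distrib_right single_add)
    next
      case False
      have "?s y + m - ?s x = ?s y + (m - ?s x)"
        by (rule poly_mapping_eqI)
          (use False in \<open>auto simp: lookup_add lookup_minus lookup_single when_def\<close>)
      then show ?thesis
        using False by (simp add: mult_single ev_diff_single lookup_add lookup_single when_def)
    qed
  qed (auto simp: distrib_left ev_diff_add algebra_simps)
qed

lemma polys_in_ev_diff:
  assumes "f \<in> polys_in S"
  shows "ev_diff x f \<in> polys_in S"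
  using assms
proof (induction rule: polys_in_induct)
  case (single m r)
  have "Poly_Mapping.keys (m - Poly_Mapping.single x 1) \<subseteq> Poly_Mapping.keys m"
    by (auto simp: in_keys_iff lookup_minus)
  then show ?case
    using single by (auto simp: ev_diff_single polys_in_def)
qed (auto simp: ev_diff_add polys_in_add)


section \<open>Solutions of the three-term recurrence\<close>

text \<open>These are the Chebyshev polynomials U_(n-1)(c/2). For c = \<alpha> + inverse \<alpha> in
  a field with \<alpha>^2 \<noteq> 1, the values are (\<alpha>^n - \<alpha>^(-n)) / (\<alpha> -
  \<alpha>^(-1)).\<close>

fun recur_nat :: "'r::comm_ring_1 \<Rightarrow> nat \<Rightarrow> 'r"
  where
    "recur_nat c 0 = 0"
  | "recur_nat c (Suc 0) = 1"
  | "recur_nat c (Suc (Suc n)) = c * recur_nat c (Suc n) - recur_nat c n"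

text \<open>The recurrence is invariant under reflection of the index, so the solution with values 0
  at 0 and 1 at 1 is odd; this fixes the values at negative indices.\<close>

definition recur :: "'r::comm_ring_1 \<Rightarrow> int \<Rightarrow> 'r"
  where "recur c x = (if 0 \<le> x then recur_nat c (nat x) else - recur_nat c (nat (- x)))"

lemma recur_0 [simp]: "recur c 0 = 0"
  and recur_1 [simp]: "recur c 1 = 1"
  by (simp_all add: recur_def)

lemma recur_uminus: "recur c (- x) = - recur c x"
  by (simp add: recur_def)

lemma recur_Suc: "recur c (x + 1) = c * recur c x - recur c (x - 1)"
proof -
  have pos: "recur c (y + 1) = c * recur c y - recur c (y - 1)" if "1 \<le> y" for y
  proof -
    define n where "n = nat (y - 1)"
    have "y = int (Suc n)" using that by (simp add: n_def)
    then show ?thesis by (simp add: recur_def nat_add_distrib flip: Suc_nat_eq_nat_zadd1)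
  qed
  consider "1 \<le> x" | "x = 0" | "1 \<le> - x" by linarith
  then show ?thesis
  proof cases
    case 2
    then show ?thesis using recur_uminus[of c 1] by simp
  next
    case 3
    have "- x + 1 = - (x - 1)" "- x - 1 = - (x + 1)" by simp_all
    then show ?thesis using pos[OF 3] by (simp only: recur_uminus) (simp add: algebra_simps)
  qed (rule pos)
qed


section \<open>The Weyl algebra\<close>

lemma ring_of_type_algebra_ring: "ring (ring_of_type_algebra :: 'a::ring_1 ring)"
proof -
  have "\<exists>y. y + x = 0 \<and> x + y = 0" for x :: 'a
    by (rule exI[of _ "- x"]) simp
  then show ?thesis
    unfolding ring_of_type_algebra_def
    by unfold_locales (auto simp: algebra_simps Units_def)
qed

lemma ring_of_type_algebra_simps [simp]:
  "carrier ring_of_type_algebra = UNIV"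
  "x \<otimes>\<^bsub>ring_of_type_algebra\<^esub> y = x * y"
  "\<one>\<^bsub>ring_of_type_algebra\<^esub> = 1"
  "\<zero>\<^bsub>ring_of_type_algebra\<^esub> = 0"
  "x \<oplus>\<^bsub>ring_of_type_algebra\<^esub> y = x + y"
  by (simp_all add: ring_of_type_algebra_def)

lemma ideal_weyl_ideal: "ideal (weyl_ideal hbar) ring_of_type_algebra"
  unfolding weyl_ideal_def
  by (rule ring.genideal_ideal[OF ring_of_type_algebra_ring]) simp

section \<open>Computations modulo the defining relation\<close>

definition weyl_eq :: "'r::comm_ring_1 \<Rightarrow> 'r free_alg \<Rightarrow> 'r free_alg \<Rightarrow> bool"
  where "weyl_eq hbar u v \<longleftrightarrow> u - v \<in> weyl_ideal hbar"

lemma weyl_ideal_zero: "0 \<in> weyl_ideal hbar"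
  and weyl_ideal_add: "u \<in> weyl_ideal hbar \<Longrightarrow> v \<in> weyl_ideal hbar \<Longrightarrow> u + v \<in> weyl_ideal hbar"
  and weyl_ideal_mult_left: "u \<in> weyl_ideal hbar \<Longrightarrow> w * u \<in> weyl_ideal hbar"
  and weyl_ideal_mult_right: "u \<in> weyl_ideal hbar \<Longrightarrow> u * w \<in> weyl_ideal hbar"
proof -
  interpret ideal "weyl_ideal hbar" ring_of_type_algebra by (rule ideal_weyl_ideal)
  show "0 \<in> weyl_ideal hbar" using additive_subgroup.zero_closed[OF is_additive_subgroup] by simp
  show "u \<in> weyl_ideal hbar \<Longrightarrow> v \<in> weyl_ideal hbar \<Longrightarrow> u + v \<in> weyl_ideal hbar"
    using additive_subgroup.a_closed[OF is_additive_subgroup] by simp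
  show "u \<in> weyl_ideal hbar \<Longrightarrow> w * u \<in> weyl_ideal hbar" using I_l_closed by simp
  show "u \<in> weyl_ideal hbar \<Longrightarrow> u * w \<in> weyl_ideal hbar" using I_r_closed by simp
qed

lemma weyl_ideal_uminus: "u \<in> weyl_ideal hbar \<Longrightarrow> - u \<in> weyl_ideal hbar"
  using weyl_ideal_mult_left[of u hbar "- 1"] by simp

lemma weyl_eq_refl [simp]: "weyl_eq hbar u u"
  by (simp add: weyl_eq_def weyl_ideal_zero)

lemma weyl_eq_sym: "weyl_eq hbar u v \<Longrightarrow> weyl_eq hbar v u"
  using weyl_ideal_uminus[of "u - v" hbar] by (simp add: weyl_eq_def)

lemma weyl_eq_trans [trans]: "weyl_eq hbar u v \<Longrightarrow> weyl_eq hbar v w \<Longrightarrow> weyl_eq hbar u w"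
  using weyl_ideal_add[of "u - v" hbar "v - w"] by (simp add: weyl_eq_def)

lemma weyl_eq_add:
  "weyl_eq hbar u v \<Longrightarrow> weyl_eq hbar u' v' \<Longrightarrow> weyl_eq hbar (u + u') (v + v')"
  using weyl_ideal_add[of "u - v" hbar "u' - v'"] by (simp add: weyl_eq_def algebra_simps)

lemma weyl_eq_uminus: "weyl_eq hbar u v \<Longrightarrow> weyl_eq hbar (- u) (- v)"
  using weyl_ideal_uminus[of "u - v" hbar] by (simp add: weyl_eq_def)

lemma weyl_eq_diff:
  "weyl_eq hbar u v \<Longrightarrow> weyl_eq hbar u' v' \<Longrightarrow> weyl_eq hbar (u - u') (v - v')"
  using weyl_eq_add[of hbar u v "- u'" "- v'"] weyl_eq_uminus[of hbar u' v'] by simp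

lemma weyl_eq_mult_left: "weyl_eq hbar u v \<Longrightarrow> weyl_eq hbar (w * u) (w * v)"
  using weyl_ideal_mult_left[of "u - v" hbar w] by (simp add: weyl_eq_def right_diff_distrib)

lemma weyl_eq_mult_right: "weyl_eq hbar u v \<Longrightarrow> weyl_eq hbar (u * w) (v * w)"
  using weyl_ideal_mult_right[of "u - v" hbar w] by (simp add: weyl_eq_def left_diff_distrib)

lemma weyl_eq_mult:
  "weyl_eq hbar u v \<Longrightarrow> weyl_eq hbar u' v' \<Longrightarrow> weyl_eq hbar (u * u') (v * v')"
  by (rule weyl_eq_trans[OF weyl_eq_mult_left weyl_eq_mult_right])

lemma weyl_eq_relation:
  "weyl_eq hbar (free_gen Gen_p * free_gen Gen_q - free_gen Gen_q * free_gen Gen_p) (free_const hbar)"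
  unfolding weyl_eq_def weyl_ideal_def
  by (rule subsetD[OF ring.genideal_self[OF ring_of_type_algebra_ring]]) simp_all

text \<open>Used with \<open>K\<close> the set of elements acting by zero in a representation:
  checking the single relation is then enough for the quotient to act.\<close>

lemma weyl_ideal_subset:
  assumes "free_gen Gen_p * free_gen Gen_q - free_gen Gen_q * free_gen Gen_p - free_const hbar \<in> K"
    and "0 \<in> K"
    and "\<And>u v. u \<in> K \<Longrightarrow> v \<in> K \<Longrightarrow> u + v \<in> K"
    and "\<And>u w. u \<in> K \<Longrightarrow> w * u \<in> K"
    and "\<And>u w. u \<in> K \<Longrightarrow> u * w \<in> K"
  shows "weyl_ideal hbar \<subseteq> K"
proof -
  let ?R = "ring_of_type_algebra :: 'a free_alg ring"
  have minus: "- u \<in> K" if "u \<in> K" for u using assms(4)[OF that, of "- 1"] by simp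
  interpret ring ?R by (rule ring_of_type_algebra_ring)
  have "ideal K ?R"
  proof (rule idealI[OF ring_of_type_algebra_ring])
    show "subgroup K (add_monoid ?R)"
    proof (rule add.subgroupI)
      show "\<ominus>\<^bsub>?R\<^esub> u \<in> K" if "u \<in> K" for u
      proof -
        have "\<ominus>\<^bsub>?R\<^esub> u = - u" by (rule minus_equality) simp_all
        then show ?thesis using minus[OF that] by simp
      qed
    qed (use assms in auto)
  qed (use assms in auto)
  then show ?thesis
    unfolding weyl_ideal_def by (rule genideal_minimal) (use assms(1) in simp)
qed

lemma weyl_class_eq: "weyl_class hbar u = {v. weyl_eq hbar v u}"
proof -
  have "v \<in> weyl_class hbar u \<longleftrightarrow> (\<exists>w\<in>weyl_ideal hbar. v = w + u)" for v
    by (simp add: weyl_class_def a_r_coset_def' )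
  then show ?thesis
    by (auto simp: weyl_eq_def) (metis diff_add_cancel)
qed

lemma weyl_class_eq_iff: "weyl_class hbar u = weyl_class hbar v \<longleftrightarrow> weyl_eq hbar u v"
  by (auto simp: weyl_class_eq intro: weyl_eq_trans weyl_eq_sym)

section \<open>Operations of the Weyl algebra on representatives\<close>

lemma weyl_algebra_carrier: "carrier (weyl_algebra hbar) = range (weyl_class hbar)"
  by (auto simp: weyl_algebra_def ring.defs module.defs FactRing_def A_RCOSETS_def' weyl_class_def)

lemma weyl_algebra_one: "\<one>\<^bsub>weyl_algebra hbar\<^esub> = weyl_class hbar 1"
  by (simp add: weyl_algebra_def ring.defs module.defs FactRing_def weyl_class_def)

lemma weyl_algebra_zero: "\<zero>\<^bsub>weyl_algebra hbar\<^esub> = weyl_class hbar 0"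
  by (auto simp: weyl_algebra_def ring.defs module.defs FactRing_def weyl_class_eq weyl_eq_def)

lemma weyl_algebra_add:
  "weyl_class hbar u \<oplus>\<^bsub>weyl_algebra hbar\<^esub> weyl_class hbar v = weyl_class hbar (u + v)"
proof -
  interpret ideal "weyl_ideal hbar" ring_of_type_algebra by (rule ideal_weyl_ideal)
  show ?thesis
    using a_rcos_sum[of u v]
    by (simp add: weyl_algebra_def ring.defs module.defs FactRing_def weyl_class_def)
qed

lemma weyl_algebra_mult:
  "weyl_class hbar u \<otimes>\<^bsub>weyl_algebra hbar\<^esub> weyl_class hbar v = weyl_class hbar (u * v)"
proof -
  interpret ideal "weyl_ideal hbar" ring_of_type_algebra by (rule ideal_weyl_ideal)
  show ?thesis
    using rcoset_mult_add[of u v]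
    by (simp add: weyl_algebra_def ring.defs module.defs FactRing_def weyl_class_def)
qed

lemma weyl_algebra_smult:
  "r \<odot>\<^bsub>weyl_algebra hbar\<^esub> weyl_class hbar u = weyl_class hbar (free_const r * u)"
proof -
  \<comment> \<open>Congruent representatives yield the same coset, so the union defining scalar
    multiplication is a single coset.\<close>
  have "weyl_class hbar (free_const r * v) = weyl_class hbar (free_const r * u)"
    if "weyl_eq hbar v u" for v
    using that by (simp add: weyl_class_eq_iff weyl_eq_mult_left)
  moreover have "weyl_class hbar u = {v. weyl_eq hbar v u}" by (rule weyl_class_eq)
  moreover have "r \<odot>\<^bsub>weyl_algebra hbar\<^esub> weyl_class hbar u =
      (\<Union>v\<in>weyl_class hbar u. weyl_class hbar (free_const r * v))"
    by (simp add: weyl_algebra_def ring.defs module.defs)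
  ultimately show ?thesis using weyl_eq_refl[of hbar u] by blast
qed

lemmas weyl_algebra_simps = weyl_algebra_carrier weyl_algebra_one weyl_algebra_zero
  weyl_algebra_add weyl_algebra_mult weyl_algebra_smult

text \<open>The record only adds scalar multiplication to the quotient ring, so the identity map
  carries over the ring axioms. The remaining axioms follow on representatives because constants are
  central in the free algebra.\<close>

lemma unital_algebra_weyl_algebra:
  "unital_algebra ring_of_type_algebra (weyl_algebra (hbar::'r::comm_ring_1))"
proof -
  let ?W = "weyl_algebra hbar"
  let ?Q = "ring_of_type_algebra Quot weyl_ideal hbar"
  interpret ideal "weyl_ideal hbar" ring_of_type_algebra by (rule ideal_weyl_ideal)
  have "id \<in> ring_iso ?Q ?W"
    by (auto simp: ring_iso_def ring_hom_def bij_betw_def weyl_algebra_def ring.defs module.defs)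
  then have "ring (?W\<lparr>ring.zero := id \<zero>\<^bsub>?Q\<^esub>\<rparr>)"
    by (rule ring.ring_iso_imp_img_ring[OF quotient_is_ring])
  moreover have "?W\<lparr>ring.zero := id \<zero>\<^bsub>?Q\<^esub>\<rparr> = ?W"
    by (simp add: weyl_algebra_def ring.defs module.defs)
  ultimately have "ring ?W" by simp
  then interpret W: ring ?W .
  interpret R: cring "ring_of_type_algebra :: 'r ring" by (rule cring_from_type_algebra)
  show ?thesis
  proof unfold_locales
    fix a b :: 'r and C D
    assume "C \<in> carrier ?W" "D \<in> carrier ?W"
    then obtain u v where [simp]: "C = weyl_class hbar u" "D = weyl_class hbar v"
      by (auto simp: weyl_algebra_simps)
    show "(a \<odot>\<^bsub>?W\<^esub> C) \<otimes>\<^bsub>?W\<^esub> D = a \<odot>\<^bsub>?W\<^esub> (C \<otimes>\<^bsub>?W\<^esub> D)"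
      by (simp add: weyl_algebra_simps mult.assoc)
    show "C \<otimes>\<^bsub>?W\<^esub> (a \<odot>\<^bsub>?W\<^esub> D) = a \<odot>\<^bsub>?W\<^esub> (C \<otimes>\<^bsub>?W\<^esub> D)"
      by (simp add: weyl_algebra_simps single_zero_left_commute[of u])
    show "a \<odot>\<^bsub>?W\<^esub> (C \<oplus>\<^bsub>?W\<^esub> D) = a \<odot>\<^bsub>?W\<^esub> C \<oplus>\<^bsub>?W\<^esub> a \<odot>\<^bsub>?W\<^esub> D"
      by (simp add: weyl_algebra_simps distrib_left)
  next
    fix a b :: 'r and C
    assume "C \<in> carrier ?W"
    then obtain u where [simp]: "C = weyl_class hbar u"
      by (auto simp: weyl_algebra_simps)
    show "a \<odot>\<^bsub>?W\<^esub> C \<in> carrier ?W"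
      by (simp add: weyl_algebra_simps)
    show "(a \<oplus>\<^bsub>ring_of_type_algebra\<^esub> b) \<odot>\<^bsub>?W\<^esub> C = a \<odot>\<^bsub>?W\<^esub> C \<oplus>\<^bsub>?W\<^esub> b \<odot>\<^bsub>?W\<^esub> C"
      by (simp add: weyl_algebra_simps single_add distrib_right)
    show "(a \<otimes>\<^bsub>ring_of_type_algebra\<^esub> b) \<odot>\<^bsub>?W\<^esub> C = a \<odot>\<^bsub>?W\<^esub> (b \<odot>\<^bsub>?W\<^esub> C)"
      by (simp add: weyl_algebra_simps flip: single_zero_mult mult.assoc)
    show "\<one>\<^bsub>ring_of_type_algebra\<^esub> \<odot>\<^bsub>?W\<^esub> C = C"
      by (simp add: weyl_algebra_simps)
  qed
qed

section \<open>Uniqueness of homomorphisms out of the Weyl algebra\<close>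

lemma free_word_Cons:
  "Poly_Mapping.single (Word (g # gs)) (1::'r::comm_ring_1) =
    free_gen g * Poly_Mapping.single (Word gs) 1"
  by (simp add: mult_single)

text \<open>Words grow by left multiplication with a generator, the form that suits homomorphisms
  and left actions.\<close>

lemma free_alg_induct [case_names one gen add scale]:
  fixes w :: "'r::comm_ring_1 free_alg"
  assumes one: "P 1"
    and gen: "\<And>g w. P w \<Longrightarrow> P (free_gen g * w)"
    and add: "\<And>u v. P u \<Longrightarrow> P v \<Longrightarrow> P (u + v)"
    and scale: "\<And>r w. P w \<Longrightarrow> P (free_const r * w)"
  shows "P w"
proof -
  have word: "P (Poly_Mapping.single (Word gs) 1)" for gs
  proof (induction gs)
    case Nil
    then show ?case using one by (simp flip: zero_weyl_word_def)
  qed (metis free_word_Cons gen)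
  have "Poly_Mapping.keys w \<subseteq> UNIV" by simp
  then show ?thesis
  proof (induction w rule: poly_mapping_span_induct)
    case zero
    show ?case using scale[OF one, of 0] by simp
  next
    case (single a r)
    obtain gs where "a = Word gs" by (cases a)
    then show ?case using scale[OF word, of r gs] by (simp add: mult_single)
  qed (rule add)
qed

lemma weyl_algebra_hom_unique:
  assumes f: "f \<in> alg_hom ring_of_type_algebra (weyl_algebra (hbar::'r::comm_ring_1)) B"
    and g: "g \<in> alg_hom ring_of_type_algebra (weyl_algebra hbar) B"
    and gen: "\<And>a. f (weyl_class hbar (free_gen a)) = g (weyl_class hbar (free_gen a))"
    and C: "C \<in> carrier (weyl_algebra hbar)"
  shows "f C = g C"
proof -
  let ?W = "weyl_algebra hbar"
  have hom: "h (C \<otimes>\<^bsub>?W\<^esub> D) = h C \<otimes>\<^bsub>B\<^esub> h D" "h (C \<oplus>\<^bsub>?W\<^esub> D) = h C \<oplus>\<^bsub>B\<^esub> h D"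
    "h (r \<odot>\<^bsub>?W\<^esub> C) = r \<odot>\<^bsub>B\<^esub> h C" "h \<one>\<^bsub>?W\<^esub> = \<one>\<^bsub>B\<^esub>"
    if "h \<in> alg_hom ring_of_type_algebra ?W B" "C \<in> carrier ?W" "D \<in> carrier ?W" for h C D r
    using that by (auto simp: alg_hom_def ring_hom_def)
  have cl: "weyl_class hbar u \<in> carrier ?W" for u by (simp add: weyl_algebra_carrier)
  have "f (weyl_class hbar w) = g (weyl_class hbar w)" for w
  proof (induction w rule: free_alg_induct)
    case one
    show ?case using hom(4)[OF f cl cl] hom(4)[OF g cl cl] by (simp add: weyl_algebra_one)
  next
    case (gen a w)
    then show ?case
      using hom(1)[OF f cl cl] hom(1)[OF g cl cl] assms(3) by (metis weyl_algebra_mult)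
  next
    case (add u v)
    then show ?case
      using hom(2)[OF f cl cl] hom(2)[OF g cl cl] by (metis weyl_algebra_add)
  next
    case (scale r w)
    then show ?case
      using hom(3)[OF f cl cl] hom(3)[OF g cl cl] by (metis weyl_algebra_smult)
  qed
  then show ?thesis using C by (auto simp: weyl_algebra_carrier)
qed


text \<open>Exponents of monomials are written with \<open>1 :: nat\<close>, which \<open>simp\<close> would turn into \<open>Suc 0\<close>.\<close>

declare One_nat_def [simp del]

section \<open>Normal ordering\<close>

text \<open>The right-hand side, as a function of \<open>x\<close>, obeys the same recurrence and
  agrees with \<open>s\<close> at \<open>m\<close> and \<open>m + 1\<close>; two neighbouring values
  determine a solution in both directions.\<close>

lemma recurrence_solution:
  fixes s :: "int \<Rightarrow> ('a::monoid_add \<Rightarrow>\<^sub>0 'r::comm_ring_1)"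
  assumes "\<And>x. s (x + 1) = Poly_Mapping.single 0 c * s x - s (x - 1)"
  shows "s x = Poly_Mapping.single 0 (recur c (x - m)) * s (m + 1) -
    Poly_Mapping.single 0 (recur c (x - m - 1)) * s m"
proof -
  define t where "t = (\<lambda>x. Poly_Mapping.single 0 (recur c (x - m)) * s (m + 1) -
    Poly_Mapping.single 0 (recur c (x - m - 1)) * s m)"
  have t: "t (x + 1) = Poly_Mapping.single 0 c * t x - t (x - 1)" for x
  proof -
    have rec: "recur c (x + 1 - m) = c * recur c (x - m) - recur c (x - 1 - m)"
      "recur c (x + 1 - m - 1) = c * recur c (x - m - 1) - recur c (x - 1 - m - 1)"
      using recur_Suc[of c "x - m"] recur_Suc[of c "x - m - 1"] by (simp_all add: algebra_simps)
    show ?thesis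
      unfolding t_def rec single_diff single_zero_mult[symmetric] by (simp add: algebra_simps)
  qed
  have "s x = t x \<and> s (x + 1) = t (x + 1)"
  proof (induction x rule: int_induct[of _ m])
    case base
    show ?case by (simp add: t_def recur_uminus[of c 1] single_uminus)
  next
    case (step1 i)
    then show ?case using assms[of "i + 1"] t[of "i + 1"] by simp
  next
    case (step2 i)
    have "s (i - 1) = Poly_Mapping.single 0 c * s i - s (i + 1)"
      "t (i - 1) = Poly_Mapping.single 0 c * t i - t (i + 1)"
      using assms[of i] t[of i] by (simp_all add: algebra_simps)
    then show ?case using step2.IH by simp
  qed
  then show ?thesis by (simp add: t_def)
qed

lemma ev_var_power: "(ev_var x :: 'r::comm_ring_1 evpoly) ^ n = Poly_Mapping.single (Poly_Mapping.single x n) 1"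
  by (induction n) (simp_all add: mult_single plus_1_eq_Suc flip: single_add)

lemma ev_diff_var_power_mult:
  "x \<noteq> y \<Longrightarrow> ev_diff x (ev_var y ^ n * f) = ev_var y ^ n * ev_diff x f"
  by (induction n) (simp_all add: mult.assoc ev_diff_var_mult)

locale oscillator =
  fixes c h hbar :: "'r::comm_ring_1" and lo hi :: int
begin

text \<open>With \<open>h\<close> standing for 1/2, the conditions X_1 + X_(-1) = c q and X_1 -
  X_(-1) = 2 p force X_1 = p + h c q. The formula combines this X_1 and X_0 = q through the
  fundamental solution \<open>recur\<close>.\<close>

definition mode :: "int \<Rightarrow> 'r free_alg"
  where "mode x =
    free_const (recur c x) * (free_gen Gen_p + free_const (h * c) * free_gen Gen_q) -
    free_const (recur c (x - 1)) * free_gen Gen_q"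

lemma mode_0: "mode 0 = free_gen Gen_q"
  and mode_1: "mode 1 = free_gen Gen_p + free_const (h * c) * free_gen Gen_q"
  by (simp_all add: mode_def recur_uminus[of c 1] single_uminus)

lemma mode_Suc: "mode (x + 1) = free_const c * mode x - mode (x - 1)"
proof -
  have "recur c (x + 1 - 1) = c * recur c (x - 1) - recur c (x - 1 - 1)"
    using recur_Suc[of c "x - 1"] by simp
  then show ?thesis
    unfolding mode_def recur_Suc[of c x]
    by (simp only: single_diff single_zero_mult[symmetric]) (simp add: algebra_simps)
qed

text \<open>The commutator of neighbours is a discrete Wronskian: when the recurrence for X_(x+2) is
  inserted, the term c X_(x+1) commutes with X_(x+1) and the rest is the previous commutator. This
  holds already in the free algebra.\<close>

lemma mode_commutator:
  "mode (x + 1) * mode x - mode x * mode (x + 1) =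
    free_gen Gen_p * free_gen Gen_q - free_gen Gen_q * free_gen Gen_p"
proof (induction x rule: int_induct[of _ 0])
  case base
  show ?case
    by (simp add: mode_0 mode_1 distrib_left distrib_right single_zero_left_commute mult.assoc)
next
  case (step1 i)
  then show ?case
    unfolding mode_Suc[of "i + 1"]
    by (simp add: left_diff_distrib right_diff_distrib single_zero_left_commute[of "mode (i + 1)"]
        mult.assoc)
next
  case (step2 i)
  then show ?case
    unfolding mode_Suc[of i]
    by (simp add: left_diff_distrib right_diff_distrib single_zero_left_commute[of "mode i"]
        mult.assoc)
qed

lemma mode_commutator_eq:
  "weyl_eq hbar (mode (x + 1) * mode x) (mode x * mode (x + 1) + free_const hbar)"
  using weyl_eq_add[OF weyl_eq_relation[of hbar] weyl_eq_refl[of hbar "mode x * mode (x + 1)"]]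
  by (simp add: add.commute flip: mode_commutator[of x])

text \<open>Each of the \<open>n\<close> factors that X_(x+1) passes contributes one
  \<open>hbar\<close>, hence \<open>hbar\<close> times the derivative of the \<open>n\<close>-th
  power. At \<open>n = 0\<close> the truncated \<open>n - 1\<close> is harmless, its coefficient
  being 0.\<close>

lemma mode_power_commutator:
  "weyl_eq hbar (mode (x + 1) * mode x ^ n)
    (mode x ^ n * mode (x + 1) + free_const (of_nat n * hbar) * mode x ^ (n - 1))"
proof (induction n)
  case (Suc n)
  let ?a = "mode x" and ?b = "mode (x + 1)" and ?k = "free_const (of_nat n * hbar)"
  have "?k * ?a ^ (n - 1) * ?a = ?k * ?a ^ n"
    by (cases n) (simp_all add: mult.assoc power_commutes)
  moreover have "?b * ?a ^ Suc n = ?b * ?a ^ n * ?a"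
    by (simp add: mult.assoc power_commutes)
  ultimately have "weyl_eq hbar (?b * ?a ^ Suc n) (?a ^ n * (?b * ?a) + ?k * ?a ^ n)"
    using weyl_eq_mult_right[OF Suc, of ?a] by (simp add: distrib_right mult.assoc)
  also have "weyl_eq hbar \<dots> (?a ^ n * (?a * ?b + free_const hbar) + ?k * ?a ^ n)"
    by (intro weyl_eq_add weyl_eq_mult_left mode_commutator_eq weyl_eq_refl)
  also have "?a ^ n * (?a * ?b + free_const hbar) + ?k * ?a ^ n =
      ?a ^ Suc n * ?b + free_const (of_nat (Suc n) * hbar) * ?a ^ (Suc n - 1)"
    by (simp add: distrib_left distrib_right single_add single_zero_commute[of "?a ^ n"]
        power_Suc2 mult.assoc del: power_Suc)
  finally show ?case .
qed simp

section \<open>Ordered monomials in the modes and normal ordering\<close>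

definition segment :: "(int \<Rightarrow>\<^sub>0 nat) \<Rightarrow> int \<Rightarrow> int \<Rightarrow> 'r free_alg"
  where "segment k a b = prod_list (map (\<lambda>x. mode x ^ Poly_Mapping.lookup k x) [a..b])"

lemma segment_cong:
  "(\<And>x. a \<le> x \<Longrightarrow> x \<le> b \<Longrightarrow> Poly_Mapping.lookup k x = Poly_Mapping.lookup k' x) \<Longrightarrow>
    segment k a b = segment k' a b"
  unfolding segment_def by (rule arg_cong[of _ _ prod_list]) auto

lemma segment_eq_1:
  assumes "\<And>x. a \<le> x \<Longrightarrow> x \<le> b \<Longrightarrow> Poly_Mapping.lookup k x = 0"
  shows "segment k a b = 1"
proof -
  have "segment k a b = segment 0 a b" by (rule segment_cong) (simp add: assms)
  moreover have "prod_list (map (\<lambda>x. mode x ^ 0) xs) = 1" for xs :: "int list"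
    by (induction xs) auto
  ultimately show ?thesis by (simp add: segment_def)
qed

lemma segment_split:
  assumes "a \<le> j" "j \<le> b + 1"
  shows "segment k a b = segment k a (j - 1) * segment k j b"
proof (cases "j \<le> b")
  case True
  then show ?thesis using assms upto_split1[of a j b] by (simp add: segment_def)
next
  case False
  then have "j = b + 1" using assms by simp
  then show ?thesis by (simp add: segment_def)
qed

lemma segment_Cons:
  "a \<le> b \<Longrightarrow> segment k a b = mode a ^ Poly_Mapping.lookup k a * segment k (a + 1) b"
  by (simp add: segment_def upto_rec1)

definition normal_order :: "'r evpoly \<Rightarrow> 'r free_alg"
  where "normal_order = lin_ext (\<lambda>k. segment k lo hi)"

lemma normal_order_zero [simp]: "normal_order 0 = 0"
  and normal_order_add: "normal_order (f + g) = normal_order f + normal_order g"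
  and normal_order_diff: "normal_order (f - g) = normal_order f - normal_order g"
  and normal_order_scale: "normal_order (ev_const r * f) = free_const r * normal_order f"
  and normal_order_single:
    "normal_order (Poly_Mapping.single k r) = free_const r * segment k lo hi"
  by (simp_all add: normal_order_def lin_ext_add lin_ext_diff lin_ext_scale)

lemma normal_order_one: "normal_order 1 = 1"
  using normal_order_single[of 0 1] segment_eq_1[of lo hi 0] by simp

text \<open>Cut after \<open>b\<close>, the ordered product of a joint monomial has one part seeing
  only \<open>f\<close> and one seeing only \<open>g\<close>; the other segments are 1. This is what
  makes the factorization product the product of the Weyl algebra.\<close>

lemma normal_order_mult:
  assumes f: "f \<in> polys_in {..b}" and g: "g \<in> polys_in {b<..}" and "lo \<le> b" "b \<le> hi"
  shows "normal_order (f * g) = normal_order f * normal_order g"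
  using f
proof (induction rule: polys_in_induct)
  case (single k r)
  show ?case using g
  proof (induction rule: polys_in_induct)
    case (single k' r')
    have z: "Poly_Mapping.lookup k x = 0" if "b < x" for x
      using that \<open>Poly_Mapping.keys k \<subseteq> {..b}\<close> by (auto simp: in_keys_iff)
    have z': "Poly_Mapping.lookup k' x = 0" if "x \<le> b" for x
      using that \<open>Poly_Mapping.keys k' \<subseteq> {b<..}\<close> by (fastforce simp: in_keys_iff)
    have split: "segment l lo hi = segment l lo b * segment l (b + 1) hi" for l
      using segment_split[of lo "b + 1" hi l] assms by simp
    have "segment (k + k') lo b = segment k lo b"
      "segment (k + k') (b + 1) hi = segment k' (b + 1) hi"
      by (rule segment_cong; simp add: lookup_add z z')+
    moreover have "segment k (b + 1) hi = 1" "segment k' lo b = 1"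
      by (rule segment_eq_1; simp add: z z')+
    ultimately have "segment (k + k') lo hi = segment k lo hi * segment k' lo hi"
      by (simp add: split)
    then show ?case
      by (simp add: mult_single normal_order_single)
        (simp add: mult.assoc single_zero_left_commute[of "segment k lo hi"] flip: single_zero_mult)
  qed (simp_all add: distrib_left normal_order_add)
qed (simp_all add: distrib_right normal_order_add)


subsection \<open>The image of the differential\<close>

text \<open>This is d_hbar of \<open>f\<close> times the odd generator at \<open>x\<close>, see
  \<open>sym_dh_degree_one\<close>.\<close>

definition bdry :: "int \<Rightarrow> 'r evpoly \<Rightarrow> 'r evpoly"
  where "bdry x f = (ev_var (x - 1) - ev_const c * ev_var x + ev_var (x + 1)) * f +
    ev_const hbar * ev_diff x f"

lemma bdry_zero [simp]: "bdry x 0 = 0"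
  and bdry_add: "bdry x (f + g) = bdry x f + bdry x g"
  and bdry_diff: "bdry x (f - g) = bdry x f - bdry x g"
  by (simp_all add: bdry_def ev_diff_add ev_diff_diff algebra_simps)

text \<open>In an ordered monomial with factor A^i B^j C^l, where A, B, C are the modes at x - 1, x,
  x + 1, the linear part of \<open>bdry\<close> inserts A before and C after B^j. The derivative
  term lets this C move in front of B^j, and then the factor A - c B + C = 0 appears.\<close>

lemma normal_order_bdry:
  assumes "lo < x" "x < hi"
  shows "weyl_eq hbar (normal_order (bdry x f)) 0"
proof -
  have "Poly_Mapping.keys f \<subseteq> UNIV" by simp
  then show ?thesis
  proof (induction f rule: poly_mapping_span_induct)
    case (single k r)
    let ?A = "mode (x - 1)" and ?B = "mode x" and ?C = "mode (x + 1)"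
    let ?k = "Poly_Mapping.lookup k"
    let ?i = "?k (x - 1)" and ?j = "?k x" and ?l = "?k (x + 1)"
    let ?L = "segment k lo (x - 2)" and ?R = "segment k (x + 1 + 1) hi"
    have split: "segment k' lo hi = ?L *
        (?A ^ Poly_Mapping.lookup k' (x - 1) * ?B ^ Poly_Mapping.lookup k' x *
          ?C ^ Poly_Mapping.lookup k' (x + 1)) * ?R"
      if "\<And>y. y \<notin> {x - 1, x, x + 1} \<Longrightarrow> Poly_Mapping.lookup k' y = ?k y" for k'
    proof -
      have "segment k' lo hi = segment k' lo (x - 2) * segment k' (x - 1) hi"
        using segment_split[of lo "x - 1" hi k'] assms by simp
      also have "segment k' (x - 1) hi =
          ?A ^ Poly_Mapping.lookup k' (x - 1) * segment k' x hi"
        using segment_Cons[of "x - 1" hi k'] assms by simp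
      also have "segment k' x hi = ?B ^ Poly_Mapping.lookup k' x * segment k' (x + 1) hi"
        by (rule segment_Cons) (use assms in simp)
      also have "segment k' (x + 1) hi =
          ?C ^ Poly_Mapping.lookup k' (x + 1) * segment k' (x + 1 + 1) hi"
        by (rule segment_Cons) (use assms in simp)
      also have "segment k' lo (x - 2) = ?L" by (rule segment_cong) (rule that, auto)
      also have "segment k' (x + 1 + 1) hi = ?R" by (rule segment_cong) (rule that, auto)
      finally show ?thesis by (simp add: mult.assoc)
    qed
    let ?s = "\<lambda>y. Poly_Mapping.single y (1::nat)"
    \<comment> \<open>\<open>?E\<close> is the right-hand side of
      \<open>mode_power_commutator\<close>, so modulo the relation it may be replaced by C B^j.
      \<open>?N\<close> collects everything around this summand.\<close>
    let ?E = "?B ^ ?j * ?C + free_const (of_nat ?j * hbar) * ?B ^ (?j - 1)"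
    let ?N = "\<lambda>e. free_const r *
      (?L * (?A ^ ?i * (?A * ?B ^ ?j - free_const c * (?B ^ ?j * ?B) + e) * ?C ^ ?l) * ?R)"
    have power: "a ^ (1 + n) = a ^ n * a" for a :: "'r free_alg" and n
      by (simp add: plus_1_eq_Suc power_commutes)
    have e1: "segment (?s (x - 1) + k) lo hi = ?L * (?A ^ ?i * (?A * ?B ^ ?j) * ?C ^ ?l) * ?R"
      and e2: "segment (?s x + k) lo hi = ?L * (?A ^ ?i * (?B ^ ?j * ?B) * ?C ^ ?l) * ?R"
      and e4: "segment (k - ?s x) lo hi = ?L * (?A ^ ?i * (?B ^ (?j - 1)) * ?C ^ ?l) * ?R"
      by (subst split; simp add: lookup_add lookup_minus lookup_single when_def mult.assoc
          power)+
    have e3: "segment (?s (x + 1) + k) lo hi = ?L * (?A ^ ?i * (?B ^ ?j * ?C) * ?C ^ ?l) * ?R"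
      by (subst split; simp add: lookup_add lookup_single when_def mult.assoc plus_1_eq_Suc)
    have var: "normal_order (ev_var y * Poly_Mapping.single k r) =
        free_const r * segment (?s y + k) lo hi" for y
      by (simp add: mult_single normal_order_single)
    have "normal_order (ev_const hbar * ev_diff x (Poly_Mapping.single k r)) =
        free_const hbar * (free_const (of_nat ?j * r) * segment (k - ?s x) lo hi)"
      by (simp add: ev_diff_single normal_order_scale normal_order_single)
    also have "\<dots> = free_const r * (free_const (of_nat ?j * hbar) * segment (k - ?s x) lo hi)"
      by (simp only: mult.assoc[symmetric] single_zero_mult) (simp add: mult.commute mult.left_commute)
    finally have diff: "normal_order (ev_const hbar * ev_diff x (Poly_Mapping.single k r)) =
        free_const r * (free_const (of_nat ?j * hbar) * segment (k - ?s x) lo hi)" .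
    have "bdry x (Poly_Mapping.single k r) = ev_var (x - 1) * Poly_Mapping.single k r -
        ev_const c * (ev_var x * Poly_Mapping.single k r) +
        ev_var (x + 1) * Poly_Mapping.single k r + ev_const hbar * ev_diff x (Poly_Mapping.single k r)"
      by (simp only: bdry_def) (simp add: algebra_simps)
    then have "normal_order (bdry x (Poly_Mapping.single k r)) = free_const r *
        (segment (?s (x - 1) + k) lo hi - free_const c * segment (?s x + k) lo hi +
          segment (?s (x + 1) + k) lo hi +
          free_const (of_nat ?j * hbar) * segment (k - ?s x) lo hi)"
      by (simp only: normal_order_add normal_order_diff normal_order_scale[of c] var diff)
        (simp add: distrib_left right_diff_distrib single_zero_left_commute[of "free_const r"])
    also have "\<dots> = ?N ?E"
      unfolding e1 e2 e3 e4
      by (simp add: distrib_left distrib_right left_diff_distrib right_diff_distrib mult.assoc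
          single_zero_left_commute[of ?L] single_zero_left_commute[of "?A ^ ?i"])
    finally have eq: "normal_order (bdry x (Poly_Mapping.single k r)) = ?N ?E" .
    have "weyl_eq hbar (?N ?E) (?N (?C * ?B ^ ?j))"
      by (intro weyl_eq_mult weyl_eq_add weyl_eq_refl weyl_eq_sym[OF mode_power_commutator])
    \<comment> \<open>\<open>mode_Suc\<close> writes C as c B - A, so the three summands
      cancel.\<close>
    moreover have "?N (?C * ?B ^ ?j) = 0"
      unfolding mode_Suc[of x] power_commutes by (simp add: left_diff_distrib mult.assoc)
    ultimately show ?case by (simp only: eq)
  next
    case (add f g)
    then show ?case
      using weyl_eq_add[OF add] by (simp add: bdry_add normal_order_add)
  qed simp
qed

text \<open>As \<open>coboundaries_0\<close> shows, these are the degree 0 coboundaries of an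
  interval whose integer points run from \<open>a\<close> to \<open>b\<close>.\<close>

definition bdrys :: "int \<Rightarrow> int \<Rightarrow> 'r evpoly set"
  where "bdrys a b = {\<Sum>x\<in>{a<..<b}. bdry x (g x) | g. \<forall>x\<in>{a<..<b}. g x \<in> polys_in {a..b}}"

lemma bdrys_zero: "0 \<in> bdrys a b"
  unfolding bdrys_def by (rule CollectI, rule exI[of _ "\<lambda>x. 0"]) simp

lemma bdrys_diff: "f \<in> bdrys a b \<Longrightarrow> g \<in> bdrys a b \<Longrightarrow> f - g \<in> bdrys a b"
proof -
  assume "f \<in> bdrys a b" "g \<in> bdrys a b"
  then obtain u v where "f = (\<Sum>x\<in>{a<..<b}. bdry x (u x))" "g = (\<Sum>x\<in>{a<..<b}. bdry x (v x))"
    "\<forall>x\<in>{a<..<b}. u x \<in> polys_in {a..b}" "\<forall>x\<in>{a<..<b}. v x \<in> polys_in {a..b}"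
    by (auto simp: bdrys_def)
  then show ?thesis
    unfolding bdrys_def
    by (intro CollectI exI[of _ "\<lambda>x. u x - v x"])
      (auto simp: bdry_diff sum_subtractf intro: polys_in_diff)
qed

lemma bdrys_add: "f \<in> bdrys a b \<Longrightarrow> g \<in> bdrys a b \<Longrightarrow> f + g \<in> bdrys a b"
  using bdrys_diff[of f a b "0 - g"] bdrys_diff[of 0 a b g] bdrys_zero[of a b] by simp

lemma bdry_in_bdrys:
  assumes "x \<in> {a<..<b}" "f \<in> polys_in {a..b}"
  shows "bdry x f \<in> bdrys a b"
  unfolding bdrys_def
  by (intro CollectI exI[of _ "\<lambda>y. if y = x then f else 0"])
    (use assms in \<open>simp add: if_distrib sum.delta cong: if_cong\<close>)

lemma bdrys_subset: "bdrys a b \<subseteq> polys_in {a..b}"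
  unfolding bdrys_def bdry_def
  by (auto intro!: polys_in_sum polys_in_add polys_in_mult polys_in_diff polys_in_var
      polys_in_ev_diff)

text \<open>Modulo the image of \<open>bdry k\<close> the variable at k + 1 can be expressed through
  lower ones, which lowers its exponent by one; induction on this exponent removes it.\<close>

lemma bdrys_reduce_step:
  assumes "a < k" "k < b" "f \<in> polys_in {a..k + 1}"
  shows "\<exists>f'\<in>polys_in {a..k}. f - f' \<in> bdrys a b"
  using assms(3)
proof (induction rule: polys_in_induct)
  case (single m r)
  have pow: "\<exists>f'\<in>polys_in {a..k}. ev_var (k + 1) ^ n * g - f' \<in> bdrys a b"
    if "g \<in> polys_in {a..k}" for g :: "'r evpoly" and n
    using that
  proof (induction n arbitrary: g)
    case 0
    then show ?case by (intro bexI[of _ g]) (simp_all add: bdrys_zero)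
  next
    case (Suc n)
    \<comment> \<open>With v the variable at k + 1, the power v^n is constant for the derivative at
      \<open>k\<close>, so \<open>bdry k\<close> sends v^n g to v^(n+1) g + v^n g'.\<close>
    define g' where "g' = (ev_var (k - 1) - ev_const c * ev_var k) * g + ev_const hbar * ev_diff k g"
    let ?v = "ev_var (k + 1) :: 'r evpoly"
    have "g' \<in> polys_in {a..k}"
      unfolding g'_def using Suc.prems assms
      by (intro polys_in_add polys_in_mult polys_in_diff polys_in_var polys_in_ev_diff
          polys_in_const) auto
    then obtain f' where f': "f' \<in> polys_in {a..k}" "?v ^ n * g' - f' \<in> bdrys a b"
      using Suc.IH by blast
    have "?v ^ n \<in> polys_in {a..b}"
      using assms by (auto simp: ev_var_power polys_in_def split: if_splits)
    then have "?v ^ n * g \<in> polys_in {a..b}"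
      using assms by (intro polys_in_mult polys_in_mono[OF _ Suc.prems]) auto
    then have "bdry k (?v ^ n * g) \<in> bdrys a b"
      using assms by (intro bdry_in_bdrys) auto
    moreover have diff: "ev_diff k (?v ^ n * g) = ?v ^ n * ev_diff k g"
      by (rule ev_diff_var_power_mult) simp
    have "?v ^ Suc n * g - - f' = bdry k (?v ^ n * g) - (?v ^ n * g' - f')"
      unfolding bdry_def g'_def diff by (simp add: algebra_simps)
    ultimately show ?case
      using bdrys_diff[OF _ f'(2)] polys_in_uminus[OF f'(1)] by metis
  qed
  define n where "n = Poly_Mapping.lookup m (k + 1)"
  let ?m = "m - Poly_Mapping.single (k + 1) n"
  have "m = Poly_Mapping.single (k + 1) n + ?m"
    by (rule poly_mapping_eqI) (simp add: n_def lookup_add lookup_minus lookup_single when_def)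
  then have "Poly_Mapping.single m r = ev_var (k + 1) ^ n * Poly_Mapping.single ?m r"
    by (simp add: ev_var_power mult_single)
  moreover have "Poly_Mapping.keys ?m \<subseteq> {a..k}"
  proof
    fix x assume x: "x \<in> Poly_Mapping.keys ?m"
    then have "x \<noteq> k + 1" "x \<in> Poly_Mapping.keys m"
      by (auto simp: in_keys_iff lookup_minus lookup_single n_def)
    then show "x \<in> {a..k}" using single by auto
  qed
  then have "Poly_Mapping.single ?m r \<in> polys_in {a..k}"
    by (auto simp: polys_in_def)
  ultimately show ?case using pow by metis
next
  case (add f g)
  then obtain f' g' where "f' \<in> polys_in {a..k}" "g' \<in> polys_in {a..k}"
    "f - f' \<in> bdrys a b" "g - g' \<in> bdrys a b" by blast
  then show ?case
    using bdrys_add[of "f - f'" a b "g - g'"] polys_in_add[of f' _ g']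
    by (intro bexI[of _ "f' + g'"]) (simp_all add: algebra_simps)
next
  case zero
  show ?case by (intro bexI[of _ 0]) (simp_all add: bdrys_zero)
qed

lemma bdrys_reduce:
  assumes "a < b" "f \<in> polys_in {a..b}"
  shows "\<exists>f'\<in>polys_in {a..a + 1}. f - f' \<in> bdrys a b"
proof -
  have "k \<le> b \<Longrightarrow> f \<in> polys_in {a..k} \<Longrightarrow> \<exists>f'\<in>polys_in {a..a + 1}. f - f' \<in> bdrys a b"
    if "a + 1 \<le> k" for k f
    using that
  proof (induction k arbitrary: f rule: int_ge_induct)
    case base
    then show ?case by (intro bexI[of _ f]) (simp_all add: bdrys_zero)
  next
    case (step k)
    then obtain f1 where f1: "f1 \<in> polys_in {a..k}" "f - f1 \<in> bdrys a b"
      using bdrys_reduce_step[of a k b f] by auto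
    then obtain f2 where "f2 \<in> polys_in {a..a + 1}" "f1 - f2 \<in> bdrys a b"
      using step.IH[of f1] step.prems by auto
    then show ?case using bdrys_add[OF f1(2), of "f1 - f2"] by auto
  qed
  from this[of b f] show ?thesis using assms by simp
qed


subsection \<open>Representations on polynomials\<close>

text \<open>In the representation with base point \<open>m\<close>, the modes at \<open>m\<close> and \<open>m + 1\<close> act as
  multiplication by \<open>\<delta>\<^sub>m\<close> and as \<open>\<delta>\<^bsub>m+1\<^esub> + hbar \<partial>/\<partial>\<delta>\<^sub>m\<close>, so that a normally ordered monomial in these
  two modes is recovered by letting it act on \<open>1\<close>.\<close>

definition shift_op :: "int \<Rightarrow> 'r evpoly \<Rightarrow> 'r evpoly"
  where "shift_op m f = ev_var (m + 1) * f + ev_const hbar * ev_diff m f"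

definition act_mode :: "int \<Rightarrow> int \<Rightarrow> 'r evpoly \<Rightarrow> 'r evpoly"
  where "act_mode m x f = ev_const (recur c (x - m)) * shift_op m f -
    ev_const (recur c (x - m - 1)) * (ev_var m * f)"

lemma shift_op_add: "shift_op m (f + g) = shift_op m f + shift_op m g"
  and shift_op_scale: "shift_op m (ev_const r * f) = ev_const r * shift_op m f"
  by (simp_all add: shift_op_def ev_diff_add ev_diff_scale distrib_left
      mult.left_commute[of _ "ev_const r"] add_ac)

lemma act_mode_add: "act_mode m x (f + g) = act_mode m x f + act_mode m x g"
  and act_mode_scale: "act_mode m x (ev_const r * f) = ev_const r * act_mode m x f"
  by (simp_all add: act_mode_def shift_op_add shift_op_scale distrib_left right_diff_distrib
      mult.left_commute[of _ "ev_const r"])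

lemma act_mode_diff: "act_mode m x (f - g) = act_mode m x f - act_mode m x g"
  using act_mode_add[of m x "f - g" g] by simp

lemma act_mode_base: "act_mode m m f = ev_var m * f"
  and act_mode_base_Suc: "act_mode m (m + 1) f = shift_op m f"
  by (simp_all add: act_mode_def recur_uminus[of c 1] single_uminus)

lemma act_mode_Suc: "act_mode m (x + 1) f = ev_const c * act_mode m x f - act_mode m (x - 1) f"
proof -
  have rec: "recur c (x + 1 - m) = c * recur c (x - m) - recur c (x - 1 - m)"
    "recur c (x + 1 - m - 1) = c * recur c (x - m - 1) - recur c (x - 1 - m - 1)"
    using recur_Suc[of c "x - m"] recur_Suc[of c "x - m - 1"] by (simp_all add: algebra_simps)
  show ?thesis
    unfolding act_mode_def rec single_diff single_zero_mult[symmetric] by (simp add: algebra_simps)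
qed

text \<open>The Wronskian argument of \<open>mode_commutator\<close> again; at the base point it is
  the Leibniz rule for the derivative at \<open>m\<close>.\<close>

lemma act_mode_commutator:
  "act_mode m (x + 1) (act_mode m x f) - act_mode m x (act_mode m (x + 1) f) = ev_const hbar * f"
proof (induction x rule: int_induct[of _ m])
  case base
  show ?case
    unfolding act_mode_base act_mode_base_Suc shift_op_def ev_diff_var_mult
    by (simp add: algebra_simps)
next
  case (step1 i)
  then show ?case
    unfolding act_mode_Suc[of m "i + 1"] by (simp add: act_mode_diff act_mode_scale)
next
  case (step2 i)
  then show ?case
    unfolding act_mode_Suc[of m i] by (simp add: act_mode_diff act_mode_scale)
qed

text \<open>The action of p comes from solving \<open>mode_1\<close> for p.\<close>

fun act_gen :: "int \<Rightarrow> weyl_gen \<Rightarrow> 'r evpoly \<Rightarrow> 'r evpoly"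
  where
    "act_gen m Gen_q f = act_mode m 0 f"
  | "act_gen m Gen_p f = act_mode m 1 f - ev_const (h * c) * act_mode m 0 f"

fun act_word :: "int \<Rightarrow> weyl_word \<Rightarrow> 'r evpoly \<Rightarrow> 'r evpoly"
  where "act_word m (Word gs) f = foldr (act_gen m) gs f"

lemma act_gen_add: "act_gen m g (f + f') = act_gen m g f + act_gen m g f'"
  and act_gen_scale: "act_gen m g (ev_const r * f) = ev_const r * act_gen m g f"
proof -
  show "act_gen m g (f + f') = act_gen m g f + act_gen m g f'"
    by (cases g) (simp_all add: act_mode_add distrib_left)
  show "act_gen m g (ev_const r * f) = ev_const r * act_gen m g f"
    by (cases g) (simp_all add: act_mode_scale right_diff_distrib mult.left_commute[of _ "ev_const r"])
qed

lemma act_word_add: "act_word m w (f + f') = act_word m w f + act_word m w f'"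
  and act_word_scale: "act_word m w (ev_const r * f) = ev_const r * act_word m w f"
proof -
  obtain gs where w: "w = Word gs" by (cases w)
  show "act_word m w (f + f') = act_word m w f + act_word m w f'"
    unfolding w by (induction gs) (simp_all add: act_gen_add)
  show "act_word m w (ev_const r * f) = ev_const r * act_word m w f"
    unfolding w by (induction gs) (simp_all add: act_gen_scale)
qed

lemma act_word_plus: "act_word m (u + v) f = act_word m u (act_word m v f)"
  by (cases u; cases v) simp

definition act :: "int \<Rightarrow> 'r free_alg \<Rightarrow> 'r evpoly \<Rightarrow> 'r evpoly"
  where "act m w f = lin_ext (\<lambda>v. act_word m v f) w"

lemma act_plus: "act m (u + v) f = act m u f + act m v f"
  and act_minus: "act m (u - v) f = act m u f - act m v f"
  and act_scalar: "act m (free_const r * u) f = ev_const r * act m u f"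
  and act_zero [simp]: "act m 0 f = 0"
  and act_single: "act m (Poly_Mapping.single a r) f = ev_const r * act_word m a f"
  by (simp_all add: act_def lin_ext_add lin_ext_diff lin_ext_scale)

lemma act_one [simp]: "act m 1 f = f"
proof -
  have "act_word m 0 f = f" by (simp add: zero_weyl_word_def)
  then show ?thesis using act_single[of m 0 1 f] by simp
qed

lemma act_const: "act m (free_const r) f = ev_const r * f"
  using act_scalar[of m r 1 f] by simp

lemma act_free_gen: "act m (free_gen g) f = act_gen m g f"
  by (simp add: act_single)

lemma act_add: "act m w (f + g) = act m w f + act m w g"
  and act_scale: "act m w (ev_const r * f) = ev_const r * act m w f"
  by (simp_all add: act_def act_word_add act_word_scale lin_ext_fun_add lin_ext_fun_scale)

lemma act_mult: "act m (u * v) f = act m u (act m v f)"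
proof -
  have "Poly_Mapping.keys u \<subseteq> UNIV" by simp
  then show ?thesis
  proof (induction u rule: poly_mapping_span_induct)
    case (single a r)
    have "Poly_Mapping.keys v \<subseteq> UNIV" by simp
    then show ?case
    proof (induction v rule: poly_mapping_span_induct)
      case zero
      show ?case using act_scale[of m _ 0] by simp
    next
      case (single b s)
      show ?case
        by (simp add: mult_single act_single act_word_plus act_word_scale)
          (simp add: mult.assoc flip: single_zero_mult)
    qed (simp add: distrib_left act_plus act_add)
  qed (simp_all add: distrib_right act_plus)
qed

lemma act_on_zero [simp]: "act m w 0 = 0"
  using act_scale[of m w 0] by simp

text \<open>The elements acting by zero form a two-sided ideal, which contains the defining relation
  by the commutator of the modes at 1 and 0. So the representation descends to the Weyl
  algebra.\<close>

lemma act_weyl_ideal: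
  assumes "w \<in> weyl_ideal hbar"
  shows "act m w f = 0"
proof -
  have "weyl_ideal hbar \<subseteq> {w. \<forall>f. act m w f = 0}"
  proof (rule weyl_ideal_subset, goal_cases)
    case 1
    have "act_mode m 1 (act_mode m 0 f) - act_mode m 0 (act_mode m 1 f) = ev_const hbar * f" for f
      using act_mode_commutator[of m 0] by simp
    then show ?case
      by (simp add: act_minus act_mult act_free_gen act_const act_mode_diff act_mode_scale)
  qed (auto simp: act_plus act_mult)
  then show ?thesis using assms by auto
qed

text \<open>Both sides solve the same recurrence and agree at 0 and 1 by the choice of
  \<open>act_gen\<close>.\<close>

lemma act_of_mode: "act m (mode x) f = act_mode m x f"
proof -
  have "act m (mode (y + 1)) f = ev_const c * act m (mode y) f - act m (mode (y - 1)) f" for y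
    unfolding mode_Suc[of y] by (simp add: act_minus act_scalar)
  from recurrence_solution[of "\<lambda>y. act m (mode y) f" c x 0, OF this]
  have "act m (mode x) f = ev_const (recur c x) * act m (mode 1) f -
      ev_const (recur c (x - 1)) * act m (mode 0) f"
    by simp
  moreover have "act m (mode 1) f = act_mode m 1 f" "act m (mode 0) f = act_mode m 0 f"
    by (simp_all add: mode_0 mode_1 act_plus act_scalar act_free_gen)
  ultimately show ?thesis
    using recurrence_solution[of "\<lambda>y. act_mode m y f" c x 0, OF act_mode_Suc] by simp
qed

section \<open>Ordered monomials in two neighbouring modes form a basis\<close>

lemma segment_two:
  assumes "Poly_Mapping.keys k \<subseteq> {m..m + 1}" "lo \<le> m" "m < hi"
  shows "segment k lo hi =
    mode m ^ Poly_Mapping.lookup k m * mode (m + 1) ^ Poly_Mapping.lookup k (m + 1)"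
proof -
  have z: "Poly_Mapping.lookup k x = 0" if "x < m \<or> m + 2 \<le> x" for x
    using that assms(1) by (force simp: in_keys_iff)
  have "segment k lo hi = segment k lo (m - 1) * segment k m hi"
    using segment_split[of lo m hi k] assms by simp
  also have "segment k m hi = mode m ^ Poly_Mapping.lookup k m * segment k (m + 1) hi"
    by (rule segment_Cons) (use assms in simp)
  also have "segment k (m + 1) hi =
      mode (m + 1) ^ Poly_Mapping.lookup k (m + 1) * segment k (m + 1 + 1) hi"
    by (rule segment_Cons) (use assms in simp)
  also have "segment k lo (m - 1) = 1" by (rule segment_eq_1) (simp add: z)
  also have "segment k (m + 1 + 1) hi = 1" by (rule segment_eq_1) (simp add: z)
  finally show ?thesis by simp
qed

text \<open>The derivative at \<open>m\<close> kills powers of \<delta>_(m+1), so on these X_(m+1)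
  is multiplication by \<delta>_(m+1); X_m then multiplies by \<delta>_m. With
  \<open>act_weyl_ideal\<close> this gives linear independence of the ordered monomials modulo the
  relation.\<close>

lemma act_normal_order:
  assumes "lo \<le> m" "m < hi" "f \<in> polys_in {m..m + 1}"
  shows "act m (normal_order f) 1 = f"
  using assms(3)
proof (induction rule: polys_in_induct)
  case (single k r)
  have z: "Poly_Mapping.lookup k x = 0" if "x \<noteq> m" "x \<noteq> m + 1" for x
    using that single by (force simp: in_keys_iff)
  have right: "act m (mode (m + 1) ^ n) 1 = ev_var (m + 1) ^ n" for n
  proof (induction n)
    case (Suc n)
    then show ?case
      using ev_diff_var_power_mult[of m "m + 1" n "1 :: 'r evpoly"]
      by (simp add: act_mult act_of_mode act_mode_base_Suc shift_op_def)
  qed simp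
  have left: "act m (mode m ^ n) g = ev_var m ^ n * g" for n g
    by (induction n) (simp_all add: act_mult act_of_mode act_mode_base mult.assoc)
  have "Poly_Mapping.single m (Poly_Mapping.lookup k m) +
      Poly_Mapping.single (m + 1) (Poly_Mapping.lookup k (m + 1)) = k"
    by (rule poly_mapping_eqI) (auto simp: lookup_add lookup_single when_def z)
  then show ?case
    using segment_two[OF single assms(1,2)]
    by (simp add: normal_order_single act_scalar act_mult act_const left right ev_var_power mult_single)
qed (simp_all add: normal_order_add act_plus)

text \<open>Left multiplication on normally ordered elements follows the representation: directly
  for X_m, by \<open>mode_power_commutator\<close> for X_(m+1), then for all modes by the recurrence
  and so for the generators. Hence the span of the ordered monomials is closed under left
  multiplication.\<close>

lemma mult_normal_order:
  assumes "lo \<le> m" "m < hi" "f \<in> polys_in {m..m + 1}"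
  shows "weyl_eq hbar (w * normal_order f) (normal_order (act m w f))"
    and "act m w f \<in> polys_in {m..m + 1}"
proof -
  have left: "mode m * normal_order f = normal_order (ev_var m * f)"
    if "f \<in> polys_in {m..m + 1}" for f
    using that
  proof (induction rule: polys_in_induct)
    case (single k r)
    have "Poly_Mapping.keys (Poly_Mapping.single m 1 + k) \<subseteq> {m..m + 1}"
      using single keys_add[of "Poly_Mapping.single m 1" k] by auto
    then show ?case
      using segment_two[OF _ assms(1,2)] single
      by (simp add: normal_order_single mult_single single_zero_left_commute[of "mode m"]
          lookup_add lookup_single mult.assoc plus_1_eq_Suc)
  qed (simp_all add: distrib_left normal_order_add)
  have right: "weyl_eq hbar (mode (m + 1) * normal_order f) (normal_order (shift_op m f))"
    if "f \<in> polys_in {m..m + 1}" for f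
    using that
  proof (induction rule: polys_in_induct)
    case (single k r)
    let ?a = "mode m" and ?b = "mode (m + 1)"
    let ?i = "Poly_Mapping.lookup k m" and ?j = "Poly_Mapping.lookup k (m + 1)"
    have "Poly_Mapping.keys (Poly_Mapping.single (m + 1) 1 + k) \<subseteq> {m..m + 1}"
      using single keys_add[of "Poly_Mapping.single (m + 1) 1" k] by auto
    then have e1: "segment (Poly_Mapping.single (m + 1) 1 + k) lo hi = ?a ^ ?i * ?b ^ Suc ?j"
      using segment_two[OF _ assms(1,2)] by (simp add: lookup_add lookup_single plus_1_eq_Suc)
    have "Poly_Mapping.keys (k - Poly_Mapping.single m 1) \<subseteq> {m..m + 1}"
      using single by (auto simp: in_keys_iff lookup_minus)
    then have e2: "segment (k - Poly_Mapping.single m 1) lo hi = ?a ^ (?i - 1) * ?b ^ ?j"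
      using segment_two[OF _ assms(1,2)] by (simp add: lookup_minus lookup_single)
    have scalars: "free_const r * (free_const (of_nat ?i * hbar) * v) =
        free_const (hbar * (of_nat ?i * r)) * v" for v
      by (simp only: mult.assoc[symmetric] single_zero_mult) (simp add: mult_ac)
    have "?b * normal_order (Poly_Mapping.single k r) = free_const r * ((?b * ?a ^ ?i) * ?b ^ ?j)"
      using segment_two[OF single assms(1,2)]
      by (simp add: normal_order_single single_zero_left_commute[of ?b] mult.assoc)
    also have "weyl_eq hbar \<dots> (free_const r *
        ((?a ^ ?i * ?b + free_const (of_nat ?i * hbar) * ?a ^ (?i - 1)) * ?b ^ ?j))"
      by (intro weyl_eq_mult weyl_eq_refl mode_power_commutator)
    also have "\<dots> = free_const r * segment (Poly_Mapping.single (m + 1) 1 + k) lo hi +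
        free_const (hbar * (of_nat ?i * r)) * segment (k - Poly_Mapping.single m 1) lo hi"
      unfolding e1 e2
      by (simp add: distrib_left distrib_right mult.assoc scalars)
    also have "\<dots> = normal_order (shift_op m (Poly_Mapping.single k r))"
      by (simp add: shift_op_def normal_order_add normal_order_scale normal_order_single mult_single
          ev_diff_single)
    finally show ?case .
  next
    case (add f g)
    then show ?case
      using weyl_eq_add[OF add] by (simp add: distrib_left normal_order_add shift_op_add)
  qed (simp add: shift_op_def)
  have mode: "weyl_eq hbar (mode x * normal_order f) (normal_order (act_mode m x f))"
    if "f \<in> polys_in {m..m + 1}" for f x
  proof -
    have "mode x * normal_order f = free_const (recur c (x - m)) * (mode (m + 1) * normal_order f) -
        free_const (recur c (x - m - 1)) * (mode m * normal_order f)"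
      by (subst recurrence_solution[of mode c x m, OF mode_Suc])
        (simp add: left_diff_distrib mult.assoc)
    also have "weyl_eq hbar \<dots> (free_const (recur c (x - m)) * normal_order (shift_op m f) -
        free_const (recur c (x - m - 1)) * normal_order (ev_var m * f))"
      unfolding left[OF that] by (intro weyl_eq_diff weyl_eq_mult weyl_eq_refl right[OF that])
    finally show ?thesis
      by (simp add: act_mode_def normal_order_diff normal_order_scale)
  qed
  have mode_in: "act_mode m x f \<in> polys_in {m..m + 1}" if "f \<in> polys_in {m..m + 1}" for f x
    unfolding act_mode_def shift_op_def using that
    by (intro polys_in_add polys_in_mult polys_in_diff polys_in_var polys_in_ev_diff
        polys_in_const) auto
  have p: "free_gen Gen_p = mode 1 - free_const (h * c) * mode 0"
    by (simp add: mode_0 mode_1)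
  have "weyl_eq hbar (w * normal_order f) (normal_order (act m w f)) \<and>
      act m w f \<in> polys_in {m..m + 1}"
  proof (induction w rule: free_alg_induct)
    case one
    then show ?case using assms by simp
  next
    case (gen g w)
    let ?f = "act m w f"
    have "weyl_eq hbar (free_gen g * normal_order ?f) (normal_order (act_gen m g ?f)) \<and>
        act_gen m g ?f \<in> polys_in {m..m + 1}"
    proof (cases g)
      case Gen_q
      then show ?thesis using mode[of ?f 0] mode_in[of ?f 0] gen by (simp add: mode_0)
    next
      case Gen_p
      have "weyl_eq hbar (mode 1 * normal_order ?f - free_const (h * c) * (mode 0 * normal_order ?f))
          (normal_order (act_mode m 1 ?f) - free_const (h * c) * normal_order (act_mode m 0 ?f))"
        using gen by (intro weyl_eq_diff weyl_eq_mult_left mode) auto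
      then show ?thesis
        unfolding Gen_p p using gen
        by (simp add: left_diff_distrib mult.assoc normal_order_diff normal_order_scale
            mode_in polys_in_diff polys_in_mult)
    qed
    moreover have "weyl_eq hbar (free_gen g * (w * normal_order f)) (free_gen g * normal_order ?f)"
      using gen by (intro weyl_eq_mult_left) auto
    ultimately show ?case
      by (auto simp: act_mult act_free_gen mult.assoc intro: weyl_eq_trans)
  next
    case (add u v)
    then show ?case
      by (auto simp: distrib_right act_plus normal_order_add intro: weyl_eq_add polys_in_add)
  next
    case (scale r w)
    then show ?case
      by (auto simp: mult.assoc act_scalar normal_order_scale intro: weyl_eq_mult_left polys_in_mult)
  qed
  then show "weyl_eq hbar (w * normal_order f) (normal_order (act m w f))"
    and "act m w f \<in> polys_in {m..m + 1}" by auto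
qed

text \<open>Since 1 is its own normal ordering, \<open>mult_normal_order\<close> at 1 shows that the
  result of \<open>w\<close> acting on 1 has normal ordering congruent to \<open>w\<close>.\<close>

lemma normal_order_surj:
  assumes "lo \<le> a" "a < b" "b \<le> hi"
  shows "\<exists>f\<in>polys_in {a..b}. weyl_eq hbar (normal_order f) w"
proof
  have "weyl_eq hbar (w * normal_order 1) (normal_order (act a w 1))"
    and "act a w 1 \<in> polys_in {a..a + 1}"
    using assms by (intro mult_normal_order; simp)+
  then show "weyl_eq hbar (normal_order (act a w 1)) w" "act a w 1 \<in> polys_in {a..b}"
    using assms by (auto simp: normal_order_one intro: weyl_eq_sym polys_in_mono[of "{a..a + 1}"])
qed

text \<open>One inclusion is \<open>normal_order_bdry\<close>. For the other, an element of the
  kernel differs by a boundary from some \<open>f'\<close> in two variables; \<open>f'\<close> lies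
  in the kernel too and is recovered by letting its normal ordering act on 1, so it is 0.\<close>

lemma bdrys_eq_kernel:
  assumes "lo \<le> a" "a < b" "b \<le> hi"
  shows "bdrys a b = {f \<in> polys_in {a..b}. weyl_eq hbar (normal_order f) 0}"
proof -
  have ker: "weyl_eq hbar (normal_order g) 0" if g: "g \<in> bdrys a b" for g
  proof -
    obtain u where "g = (\<Sum>x\<in>{a<..<b}. bdry x (u x))" using g unfolding bdrys_def by blast
    moreover have "weyl_eq hbar (normal_order (\<Sum>x\<in>K. bdry x (u x))) 0"
      if "K \<subseteq> {a<..<b}" for K
      using that
    proof (induction K rule: infinite_finite_induct)
      case (insert x K)
      then show ?case
        using weyl_eq_add[OF normal_order_bdry[of x "u x"]] assms by (force simp: normal_order_add)
    qed simp_all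
    ultimately show ?thesis by simp
  qed
  moreover have "f \<in> bdrys a b" if f: "f \<in> polys_in {a..b}" "weyl_eq hbar (normal_order f) 0" for f
  proof -
    obtain f' where f': "f' \<in> polys_in {a..a + 1}" "f - f' \<in> bdrys a b"
      using bdrys_reduce[OF assms(2) f(1)] by auto
    have "weyl_eq hbar (normal_order f - normal_order (f - f')) (0 - 0)"
      using f(2) ker[OF f'(2)] by (rule weyl_eq_diff)
    then have "normal_order f' \<in> weyl_ideal hbar"
      by (simp add: normal_order_diff weyl_eq_def)
    then have "f' = 0"
      using act_weyl_ideal[of "normal_order f'" a 1] act_normal_order[OF assms(1) _ f'(1)] assms
      by simp
    then show ?thesis using f'(2) by simp
  qed
  ultimately show ?thesis using bdrys_subset[of a b] by auto
qed

end


section \<open>Transport of the algebra structure\<close>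

text \<open>The axioms for \<open>B\<close> are transported along the bijection.
  \<open>ring_hom\<close> puts no condition on zero, so agreement of the zeros enters
  separately.\<close>

lemma unital_algebra_alg_iso:
  assumes "unital_algebra R A" and f: "f \<in> alg_iso R A B" and zero: "f \<zero>\<^bsub>A\<^esub> = \<zero>\<^bsub>B\<^esub>"
  shows "unital_algebra R B"
proof -
  interpret A: unital_algebra R A by fact
  have hom: "f \<in> ring_hom A B"
    and smult: "\<And>r x. r \<in> carrier R \<Longrightarrow> x \<in> carrier A \<Longrightarrow> f (r \<odot>\<^bsub>A\<^esub> x) = r \<odot>\<^bsub>B\<^esub> f x"
    and bij: "bij_betw f (carrier A) (carrier B)"
    using f by (auto simp: alg_iso_def alg_hom_def)
  have mult: "f (x \<otimes>\<^bsub>A\<^esub> y) = f x \<otimes>\<^bsub>B\<^esub> f y" and add: "f (x \<oplus>\<^bsub>A\<^esub> y) = f x \<oplus>\<^bsub>B\<^esub> f y"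
    if "x \<in> carrier A" "y \<in> carrier A" for x y
    using hom that by (auto simp: ring_hom_def)
  have "ring (B\<lparr>ring.zero := f \<zero>\<^bsub>A\<^esub>\<rparr>)"
    by (rule A.ring_iso_imp_img_ring) (use hom bij in \<open>simp add: ring_iso_def\<close>)
  then have "ring B" by (simp add: zero)
  then interpret B: ring B .
  have carrier: "carrier B = f ` carrier A" using bij by (simp add: bij_betw_def)
  show ?thesis
  proof unfold_locales
    fix a b x y assume a: "a \<in> carrier R" "b \<in> carrier R" and "x \<in> carrier B"
    then obtain x' where x: "x = f x'" "x' \<in> carrier A" by (auto simp: carrier)
    show "a \<odot>\<^bsub>B\<^esub> x \<in> carrier B"
      using a x by (simp add: carrier flip: smult)
    show "(a \<oplus>\<^bsub>R\<^esub> b) \<odot>\<^bsub>B\<^esub> x = a \<odot>\<^bsub>B\<^esub> x \<oplus>\<^bsub>B\<^esub> b \<odot>\<^bsub>B\<^esub> x"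
      using a x by (simp add: A.smult_l_distr flip: smult add)
    show "(a \<otimes>\<^bsub>R\<^esub> b) \<odot>\<^bsub>B\<^esub> x = a \<odot>\<^bsub>B\<^esub> (b \<odot>\<^bsub>B\<^esub> x)"
      using a x by (simp add: A.smult_assoc1 flip: smult)
  next
    fix x assume "x \<in> carrier B"
    then obtain x' where x: "x = f x'" "x' \<in> carrier A" by (auto simp: carrier)
    show "\<one>\<^bsub>R\<^esub> \<odot>\<^bsub>B\<^esub> x = x"
      using x by (simp flip: smult)
  next
    fix a x y assume a: "a \<in> carrier R" and "x \<in> carrier B" "y \<in> carrier B"
    then obtain x' y' where x: "x = f x'" "x' \<in> carrier A" and y: "y = f y'" "y' \<in> carrier A"
      by (auto simp: carrier)
    show "a \<odot>\<^bsub>B\<^esub> (x \<oplus>\<^bsub>B\<^esub> y) = a \<odot>\<^bsub>B\<^esub> x \<oplus>\<^bsub>B\<^esub> a \<odot>\<^bsub>B\<^esub> y"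
      using a x y by (simp add: A.smult_r_distr flip: smult add)
    show "(a \<odot>\<^bsub>B\<^esub> x) \<otimes>\<^bsub>B\<^esub> y = a \<odot>\<^bsub>B\<^esub> (x \<otimes>\<^bsub>B\<^esub> y)"
      using a x y by (simp add: A.smult_mult_left flip: smult mult)
    show "x \<otimes>\<^bsub>B\<^esub> (a \<odot>\<^bsub>B\<^esub> y) = a \<odot>\<^bsub>B\<^esub> (x \<otimes>\<^bsub>B\<^esub> y)"
      using a x y by (simp add: A.smult_mult_right flip: smult mult)
  qed
qed


section \<open>The observables\<close>

lemma inj_sym_even: "inj sym_even"
  by (rule injI) (metis sym_even_def)

lemma sym_add_even: "sym_add (sym_even f) (sym_even g) = sym_even (f + g)"
  by (auto simp: sym_add_def sym_even_def)

lemma sym_smult_even: "sym_smult r (sym_even f) = sym_even (ev_const r * f)"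
  by (auto simp: sym_smult_def sym_even_def)

lemma sym_zero_eq: "sym_zero = sym_even 0"
  by (auto simp: sym_zero_def sym_even_def)

lemma sym_mult_even: "sym_mult (sym_even f) (sym_even g) = sym_even (f * g)"
proof
  fix U :: "int set"
  show "sym_mult (sym_even f) (sym_even g) U = sym_even (f * g) U"
  proof (cases "U = {}")
    case True
    then show ?thesis by (simp add: sym_mult_def sym_even_def koszul_sign_def)
  next
    case False
    then have "koszul_sign S (U - S) * sym_even f S * sym_even g (U - S) = 0" for S
      by (simp add: sym_even_def)
    then have "sym_mult (sym_even f) (sym_even g) U = 0"
      unfolding sym_mult_def by (intro sum.neutral) blast
    then show ?thesis using False by (simp add: sym_even_def)
  qed
qed

lemma odd_diff_even: "odd_diff x (sym_even f) = sym_zero"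
  by (auto simp: odd_diff_def sym_even_def sym_zero_def)

lemma sym_dh_even: "sym_dh \<iota> \<alpha> hbar I (sym_even f) = sym_zero"
proof -
  have "(\<lambda>S. ev_diff x (sym_even f S)) = sym_even (ev_diff x f)" for x
    by (auto simp: sym_even_def)
  then have "sym_Delta I (sym_even f) = sym_zero"
    by (auto simp: sym_Delta_def odd_diff_even) (simp add: sym_zero_def)
  then show ?thesis
    by (simp add: sym_dh_def sym_d_even) (simp add: sym_add_def sym_smult_def sym_zero_def)
qed

lemma finite_inner_points: "finite (inner_points I)"
  by (simp add: inner_points_def finite_points)

section \<open>Cochains of degree 0 and -1 in terms of polynomials\<close>

lemma sym_deg_0: "sym_deg I 0 = sym_even ` polys_in (points I)"
proof (intro equalityI subsetI)
  fix F :: "'r::comm_ring_1 sym" assume F: "F \<in> sym_deg I 0"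
  have "F S = 0" if "S \<noteq> {}" for S
  proof (rule ccontr)
    assume "F S \<noteq> 0"
    then have "S \<subseteq> inner_points I" "card S = 0"
      using F by (auto simp: sym_deg_def sym_alg_def)
    \<comment> \<open>\<open>card\<close> is 0 also on infinite sets; finiteness of the set of inner
      points excludes these.\<close>
    then show False using that finite_inner_points[of I] by (auto dest: finite_subset)
  qed
  then have "F = sym_even (F {})" by (auto simp: sym_even_def)
  moreover have "F {} \<in> polys_in (points I)"
    using F by (auto simp: sym_deg_def sym_alg_def polys_in_def)
  ultimately show "F \<in> sym_even ` polys_in (points I)" by blast
qed (auto simp: sym_deg_def sym_alg_def polys_in_def sym_even_def split: if_splits)

lemma cocycles_0: "cocycles \<iota> \<alpha> hbar I 0 = sym_even ` polys_in (points I)"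
  by (auto simp: cocycles_def sym_deg_0 sym_dh_even)

lemma odd_diff_degree_one:
  assumes "F \<in> sym_alg I" "\<And>S. F S \<noteq> 0 \<Longrightarrow> card S = 1"
  shows "odd_diff x F = sym_even (F {x})"
proof
  fix U
  have "F (insert x U) = 0" if "x \<notin> U" "U \<noteq> {}"
  proof (rule ccontr)
    assume "F (insert x U) \<noteq> 0"
    then have "insert x U \<subseteq> inner_points I" "card (insert x U) = 1"
      using assms by (auto simp: sym_alg_def)
    moreover from this have "finite U" using finite_inner_points[of I] by (auto dest: finite_subset)
    ultimately show False using that by simp
  qed
  then show "odd_diff x F U = sym_even (F {x}) U"
    by (auto simp: odd_diff_def sym_even_def)
qed

lemma ev_linear_diff:
  assumes "\<And>a b. \<iota> (a - b) = \<iota> a - \<iota> b"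
  shows "ev_linear \<iota> I (g - h) = ev_linear \<iota> I g - ev_linear \<iota> I h"
  by (simp add: ev_linear_def assms single_diff left_diff_distrib sum_subtractf)

lemma ev_linear_delta:
  assumes "\<iota> 0 = 0" "\<iota> 1 = 1" "x \<in> points I"
  shows "ev_linear \<iota> I (delta x) = ev_var x"
proof -
  have "ev_const (\<iota> (delta x y)) * ev_var y = (if y = x then ev_var y else 0)" for y
    using assms by (simp add: delta_def)
  then show ?thesis using assms(3) finite_points[of I] by (simp add: ev_linear_def)
qed

text \<open>Treats the three choices of scalars together. The assumptions also give that twice
  \<open>\<iota> (1 / 2)\<close> is 1, which the formula for p uses.\<close>

locale observables =
  fixes \<iota> :: "'k::field_char_0 \<Rightarrow> 'r::comm_ring_1" and \<alpha> :: 'k and hbar :: 'r and lo hi :: int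
  assumes \<iota>_add: "\<iota> (a + b) = \<iota> a + \<iota> b"
    and \<iota>_one: "\<iota> 1 = 1"
begin

sublocale oscillator "\<iota> (\<alpha> + inverse \<alpha>)" "\<iota> (1 / 2)" hbar lo hi .

lemma \<iota>_zero: "\<iota> 0 = 0"
  using \<iota>_add[of 0 0] by simp

lemma \<iota>_diff: "\<iota> (a - b) = \<iota> a - \<iota> b"
  using \<iota>_add[of "a - b" b] by simp

text \<open>Replaces real end points by the first and last integer point inside. \<open>lo\<close>
  and \<open>hi\<close> will belong to the large interval, so that one normal ordering serves all
  intervals.\<close>

definition spans :: "interval \<Rightarrow> int \<Rightarrow> int \<Rightarrow> bool"
  where "spans I a b \<longleftrightarrow> points I = {a..b} \<and> inner_points I = {a<..<b} \<and> lo \<le> a \<and> a < b \<and> b \<le> hi"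

lemma ev_linear_Q_delta:
  assumes "x - 1 \<in> points I" "x \<in> points I" "x + 1 \<in> points I"
  shows "ev_linear \<iota> I (Q_op \<alpha> (delta x)) =
    ev_var (x - 1) - ev_const (\<iota> (\<alpha> + inverse \<alpha>)) * ev_var x + ev_var (x + 1)"
proof -
  let ?c = "ev_const (\<iota> (\<alpha> + inverse \<alpha>)) :: 'r evpoly"
  have "ev_const (\<iota> (Q_op \<alpha> (delta x) y)) * ev_var y =
      (if y = x - 1 then ev_var (x - 1) else 0) - (if y = x then ?c * ev_var x else 0) +
      (if y = x + 1 then ev_var (x + 1) else 0)" for y
    by (auto simp: Q_op_def delta_def \<iota>_diff \<iota>_zero \<iota>_one single_uminus)
  then show ?thesis
    using assms finite_points[of I] by (simp add: ev_linear_def sum.distrib sum_subtractf)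
qed

text \<open>An element of degree -1 is determined by its coefficients at singletons, and the odd
  derivative at \<open>x\<close> extracts the one at {x}.\<close>

lemma sym_dh_degree_one:
  assumes "spans I a b" and F: "F \<in> sym_alg I" "\<And>S. F S \<noteq> 0 \<Longrightarrow> card S = 1"
  shows "sym_dh \<iota> \<alpha> hbar I F = sym_even (\<Sum>x\<in>{a<..<b}. bdry x (F {x}))"
proof -
  have "odd_diff x (\<lambda>S. ev_diff x (F S)) = sym_even (ev_diff x (F {x}))" for x
  proof (rule odd_diff_degree_one)
    show "(\<lambda>S. ev_diff x (F S)) \<in> sym_alg I"
    proof -
      have "F S \<in> polys_in (points I)" for S
        using F(1) by (auto simp: sym_alg_def polys_in_def)
      then have "ev_diff x (F S) \<in> polys_in (points I)" for S by (rule polys_in_ev_diff)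
      moreover have "F S \<noteq> 0" if "ev_diff x (F S) \<noteq> 0" for S using that by auto
      ultimately show ?thesis using F(1) unfolding sym_alg_def polys_in_def by blast
    qed
    show "card S = 1" if "ev_diff x (F S) \<noteq> 0" for S
      using that F(2)[of S] by (cases "F S = 0") auto
  qed
  moreover have "odd_diff x F = sym_even (F {x})" for x
    using F by (rule odd_diff_degree_one)
  moreover have "ev_linear \<iota> I (Q_op \<alpha> (delta x)) =
      ev_var (x - 1) - ev_const (\<iota> (\<alpha> + inverse \<alpha>)) * ev_var x + ev_var (x + 1)"
    if "x \<in> {a<..<b}" for x
    using that assms(1) by (intro ev_linear_Q_delta) (auto simp: spans_def)
  ultimately show ?thesis
    using assms(1)
    by (auto simp: sym_dh_def sym_d_def sym_Delta_def sym_add_def sym_smult_def sym_even_def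
        spans_def bdry_def sum.distrib sum_distrib_left)
qed

lemma coboundaries_0:
  assumes "spans I a b"
  shows "coboundaries \<iota> \<alpha> hbar I 0 = sym_even ` bdrys a b"
proof (intro equalityI subsetI)
  fix G assume "G \<in> coboundaries \<iota> \<alpha> hbar I 0"
  then obtain F where F: "F \<in> sym_alg I" "\<And>S. F S \<noteq> 0 \<Longrightarrow> card S = 1"
    and G: "G = sym_dh \<iota> \<alpha> hbar I F"
    by (force simp: coboundaries_def sym_deg_def)
  have "F S \<in> polys_in {a..b}" for S
    using F(1) assms by (auto simp: sym_alg_def polys_in_def spans_def)
  then have "(\<Sum>x\<in>{a<..<b}. bdry x (F {x})) \<in> bdrys a b"
    unfolding bdrys_def by (auto intro!: exI[of _ "\<lambda>x. F {x}"])
  moreover have "G = sym_even (\<Sum>x\<in>{a<..<b}. bdry x (F {x}))"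
    unfolding G by (rule sym_dh_degree_one[OF assms F])
  ultimately show "G \<in> sym_even ` bdrys a b" by blast
next
  fix G assume "G \<in> sym_even ` bdrys a b"
  then obtain g where g: "\<forall>x\<in>{a<..<b}. g x \<in> polys_in {a..b}"
    and G: "G = sym_even (\<Sum>x\<in>{a<..<b}. bdry x (g x))"
    unfolding bdrys_def by blast
  \<comment> \<open>The preimage puts \<open>g x\<close> at the odd generator with index x;
    \<open>the_elem\<close> reads the index off the singleton.\<close>
  define F where "F = (\<lambda>S. if \<exists>x\<in>{a<..<b}. S = {x} then g (the_elem S) else 0)"
  have "F S \<in> polys_in (points I)" for S
    using g assms by (auto simp: F_def spans_def)
  moreover have supp: "S \<subseteq> inner_points I \<and> card S = 1" if "F S \<noteq> 0" for S
    using that assms by (auto simp: F_def spans_def split: if_splits)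
  ultimately have F: "F \<in> sym_alg I"
    unfolding sym_alg_def polys_in_def by blast
  then have "F \<in> sym_deg I (0 - 1)" using supp by (auto simp: sym_deg_def)
  moreover have "sym_dh \<iota> \<alpha> hbar I F = sym_even (\<Sum>x\<in>{a<..<b}. bdry x (F {x}))"
    using assms F by (rule sym_dh_degree_one) (use supp in blast)
  then have "G = sym_dh \<iota> \<alpha> hbar I F"
    unfolding G by (simp add: F_def)
  ultimately show "G \<in> coboundaries \<iota> \<alpha> hbar I 0" unfolding coboundaries_def by blast
qed

text \<open>The inverse of normal ordering on classes. Elements of both algebras are sets of
  representatives, so the preimage of a coset is a cohomology class, without any choice, and one
  coset labels a class on every interval.\<close>

definition obs_of_weyl :: "int \<Rightarrow> int \<Rightarrow> 'r free_alg set \<Rightarrow> 'r sym set"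
  where "obs_of_weyl a b C = sym_even ` {f \<in> polys_in {a..b}. normal_order f \<in> C}"

text \<open>By \<open>bdrys_eq_kernel\<close>, two polynomials on \<open>I\<close> are cohomologous
  exactly when their normal orderings are congruent.\<close>

lemma H0_class_even:
  assumes "spans I a b" "f \<in> polys_in {a..b}"
  shows "H0_class \<iota> \<alpha> hbar I (sym_even f) = obs_of_weyl a b (weyl_class hbar (normal_order f))"
proof -
  have "H0_class \<iota> \<alpha> hbar I (sym_even f) = sym_even ` ((+) f ` bdrys a b)"
    by (simp add: H0_class_def coboundaries_0[OF assms(1)] image_image sym_add_even)
  also have "(+) f ` bdrys a b = {f' \<in> polys_in {a..b}. normal_order f' \<in> weyl_class hbar (normal_order f)}"
  proof (intro equalityI subsetI)
    fix f' assume "f' \<in> (+) f ` bdrys a b"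
    then obtain g where "f' = f + g" "g \<in> polys_in {a..b}" "weyl_eq hbar (normal_order g) 0"
      using bdrys_eq_kernel[of a b] assms(1) by (auto simp: spans_def)
    then show "f' \<in> {f' \<in> polys_in {a..b}. normal_order f' \<in> weyl_class hbar (normal_order f)}"
      using assms(2) by (auto simp: weyl_class_eq normal_order_add weyl_eq_def intro: polys_in_add)
  next
    fix f' assume f': "f' \<in> {f' \<in> polys_in {a..b}. normal_order f' \<in> weyl_class hbar (normal_order f)}"
    then have "f' - f \<in> bdrys a b"
      using bdrys_eq_kernel[of a b] assms
      by (auto simp: spans_def weyl_class_eq normal_order_diff weyl_eq_def intro: polys_in_diff)
    then show "f' \<in> (+) f ` bdrys a b" by (intro image_eqI[of _ _ "f' - f"]) auto
  qed
  finally show ?thesis by (simp add: obs_of_weyl_def)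
qed

lemma weyl_algebra_carrierE:
  assumes "spans I a b" "C \<in> carrier (weyl_algebra hbar)"
  obtains f where "f \<in> polys_in {a..b}" "C = weyl_class hbar (normal_order f)"
proof -
  obtain w where "C = weyl_class hbar w" using assms(2) by (auto simp: weyl_algebra_carrier)
  moreover obtain f where "f \<in> polys_in {a..b}" "weyl_eq hbar (normal_order f) w"
    using normal_order_surj[of a b w] assms(1) by (auto simp: spans_def)
  ultimately show thesis using that by (simp add: weyl_class_eq_iff weyl_eq_sym)
qed

lemma H0_eq:
  assumes "spans I a b"
  shows "H0 \<iota> \<alpha> hbar I = obs_of_weyl a b ` carrier (weyl_algebra hbar)"
proof -
  have "H0 \<iota> \<alpha> hbar I = (\<lambda>f. obs_of_weyl a b (weyl_class hbar (normal_order f))) ` polys_in {a..b}"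
    using assms H0_class_even[OF assms]
    by (auto simp: H0_def cocycles_0 spans_def image_image)
  also have "\<dots> = obs_of_weyl a b ` carrier (weyl_algebra hbar)"
  proof (intro equalityI subsetI)
    fix F assume "F \<in> obs_of_weyl a b ` carrier (weyl_algebra hbar)"
    then obtain C where "F = obs_of_weyl a b C" "C \<in> carrier (weyl_algebra hbar)" by auto
    then show "F \<in> (\<lambda>f. obs_of_weyl a b (weyl_class hbar (normal_order f))) ` polys_in {a..b}"
      using weyl_algebra_carrierE[OF assms] by (metis imageI)
  qed (auto simp: weyl_algebra_carrier)
  finally show ?thesis .
qed

lemma inj_on_obs_of_weyl:
  assumes "spans I a b"
  shows "inj_on (obs_of_weyl a b) (carrier (weyl_algebra hbar))"
proof (rule inj_onI)
  fix C D assume C: "C \<in> carrier (weyl_algebra hbar)" and D: "D \<in> carrier (weyl_algebra hbar)"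
    and eq: "obs_of_weyl a b C = obs_of_weyl a b D"
  obtain f where f: "f \<in> polys_in {a..b}" "C = weyl_class hbar (normal_order f)"
    using weyl_algebra_carrierE[OF assms C] .
  then have "sym_even f \<in> obs_of_weyl a b D"
    using eq by (auto simp: obs_of_weyl_def weyl_class_eq)
  then have "normal_order f \<in> D"
    using injD[OF inj_sym_even] by (auto simp: obs_of_weyl_def)
  moreover obtain w where "D = weyl_class hbar w" using D by (auto simp: weyl_algebra_carrier)
  ultimately have "weyl_class hbar (normal_order f) = D"
    by (metis mem_Collect_eq weyl_class_eq weyl_class_eq_iff)
  then show "C = D" using f(2) by simp
qed

lemma obs_of_weyl_nonempty:
  assumes "spans I a b" "C \<in> carrier (weyl_algebra hbar)"
  shows "obs_of_weyl a b C \<noteq> {}"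
proof -
  obtain f where "f \<in> polys_in {a..b}" "C = weyl_class hbar (normal_order f)"
    using weyl_algebra_carrierE[OF assms] .
  then have "sym_even f \<in> obs_of_weyl a b C" by (auto simp: obs_of_weyl_def weyl_class_eq)
  then show ?thesis by blast
qed

lemma obs_of_weylE:
  assumes "F \<in> obs_of_weyl a b C" "C \<in> carrier (weyl_algebra hbar)"
  obtains f where "F = sym_even f" "f \<in> polys_in {a..b}" "C = weyl_class hbar (normal_order f)"
proof -
  obtain f w where f: "F = sym_even f" "f \<in> polys_in {a..b}" "normal_order f \<in> C" "C = weyl_class hbar w"
    using assms by (auto simp: obs_of_weyl_def weyl_algebra_carrier)
  then have "C = weyl_class hbar (normal_order f)"
    by (metis mem_Collect_eq weyl_class_eq weyl_class_eq_iff)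
  then show thesis using f that by blast
qed

text \<open>Normal ordering runs from \<open>lo\<close> to \<open>hi\<close> for every interval, so
  a representative keeps its coset in the larger interval: inclusions become the identity of the
  Weyl algebra.\<close>

lemma H0_incl_obs_of_weyl:
  assumes I: "spans I a b" and J: "spans J lo hi" and C: "C \<in> carrier (weyl_algebra hbar)"
  shows "H0_incl \<iota> \<alpha> hbar J (obs_of_weyl a b C) = obs_of_weyl lo hi C"
proof -
  have "H0_class \<iota> \<alpha> hbar J F = obs_of_weyl lo hi C" if F: "F \<in> obs_of_weyl a b C" for F
  proof -
    obtain f where f: "F = sym_even f" "f \<in> polys_in {a..b}" "C = weyl_class hbar (normal_order f)"
      using obs_of_weylE[OF F C] .
    then have "f \<in> polys_in {lo..hi}"
      using polys_in_mono[of "{a..b}" "{lo..hi}" f] I by (auto simp: spans_def)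
    then show ?thesis using f H0_class_even[OF J] by simp
  qed
  then show ?thesis
    unfolding H0_incl_def using obs_of_weyl_nonempty[OF I C] by auto
qed

text \<open>Injectivity of \<open>obs_of_weyl\<close> for \<open>J\<close> makes the inclusion
  injective on classes, so \<open>inv_into\<close> finds the unique preimage.\<close>

lemma inv_H0_incl:
  assumes I: "spans I a b" and J: "spans J lo hi" and C: "C \<in> carrier (weyl_algebra hbar)"
  shows "inv_into (H0 \<iota> \<alpha> hbar I) (H0_incl \<iota> \<alpha> hbar J) (obs_of_weyl lo hi C) = obs_of_weyl a b C"
proof -
  have "inj_on (H0_incl \<iota> \<alpha> hbar J) (H0 \<iota> \<alpha> hbar I)"
  proof (rule inj_onI)
    fix F G assume "F \<in> H0 \<iota> \<alpha> hbar I" "G \<in> H0 \<iota> \<alpha> hbar I"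
      and eq: "H0_incl \<iota> \<alpha> hbar J F = H0_incl \<iota> \<alpha> hbar J G"
    then obtain C D where "F = obs_of_weyl a b C" "C \<in> carrier (weyl_algebra hbar)"
      "G = obs_of_weyl a b D" "D \<in> carrier (weyl_algebra hbar)"
      by (auto simp: H0_eq[OF I])
    then show "F = G"
      using eq H0_incl_obs_of_weyl[OF I J] inj_onD[OF inj_on_obs_of_weyl[OF J]] by metis
  qed
  moreover have "obs_of_weyl a b C \<in> H0 \<iota> \<alpha> hbar I" using C by (simp add: H0_eq[OF I])
  ultimately show ?thesis
    using inv_into_f_f H0_incl_obs_of_weyl[OF I J C] by metis
qed

text \<open>Inverting the inclusions keeps the cosets and moves the representatives into the small
  intervals, where \<open>b\<^sub>1\<close> separates them and \<open>normal_order_mult\<close>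
  applies.\<close>

lemma star_obs_of_weyl:
  assumes I1: "spans I\<^sub>1 a\<^sub>1 b\<^sub>1" and I2: "spans I\<^sub>2 a\<^sub>2 b\<^sub>2" and "b\<^sub>1 < a\<^sub>2" and J: "spans J lo hi"
    and C: "C \<in> carrier (weyl_algebra hbar)" and D: "D \<in> carrier (weyl_algebra hbar)"
  shows "star \<iota> \<alpha> hbar I\<^sub>1 I\<^sub>2 J (obs_of_weyl lo hi C) (obs_of_weyl lo hi D) =
    obs_of_weyl lo hi (C \<otimes>\<^bsub>weyl_algebra hbar\<^esub> D)"
proof -
  have "H0_class \<iota> \<alpha> hbar J (sym_mult F G) = obs_of_weyl lo hi (C \<otimes>\<^bsub>weyl_algebra hbar\<^esub> D)"
    if F: "F \<in> obs_of_weyl a\<^sub>1 b\<^sub>1 C" and G: "G \<in> obs_of_weyl a\<^sub>2 b\<^sub>2 D" for F G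
  proof -
    obtain f where f: "F = sym_even f" "f \<in> polys_in {a\<^sub>1..b\<^sub>1}" "C = weyl_class hbar (normal_order f)"
      using obs_of_weylE[OF F C] .
    obtain g where g: "G = sym_even g" "g \<in> polys_in {a\<^sub>2..b\<^sub>2}" "D = weyl_class hbar (normal_order g)"
      using obs_of_weylE[OF G D] .
    have "f \<in> polys_in {lo..hi}" "g \<in> polys_in {lo..hi}"
      using polys_in_mono[OF _ f(2), of "{lo..hi}"] polys_in_mono[OF _ g(2), of "{lo..hi}"] I1 I2
      by (auto simp: spans_def)
    then have "H0_class \<iota> \<alpha> hbar J (sym_even (f * g)) =
        obs_of_weyl lo hi (weyl_class hbar (normal_order (f * g)))"
      by (intro H0_class_even[OF J] polys_in_mult)
    also have "normal_order (f * g) = normal_order f * normal_order g"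
    proof (rule normal_order_mult[where b = b\<^sub>1])
      show "f \<in> polys_in {..b\<^sub>1}" by (rule polys_in_mono[OF _ f(2)]) auto
      show "g \<in> polys_in {b\<^sub>1<..}" by (rule polys_in_mono[OF _ g(2)]) (use assms(3) in auto)
      show "lo \<le> b\<^sub>1" "b\<^sub>1 \<le> hi" using I1 by (auto simp: spans_def)
    qed
    finally show ?thesis using f g by (simp add: sym_mult_even weyl_algebra_mult)
  qed
  then show ?thesis
    unfolding star_def inv_H0_incl[OF I1 J C] inv_H0_incl[OF I2 J D] fact_product_def
    using obs_of_weyl_nonempty[OF I1 C] obs_of_weyl_nonempty[OF I2 D] by auto
qed

section \<open>The isomorphism and its values on the generators\<close>

lemma normal_order_var:
  assumes "lo \<le> x" "x \<le> hi"
  shows "normal_order (ev_var x) = mode x"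
proof -
  let ?k = "Poly_Mapping.single x (1::nat)"
  have "segment ?k lo hi = segment ?k lo (x - 1) * segment ?k x hi"
    by (rule segment_split) (use assms in auto)
  also have "segment ?k x hi = mode x ^ Poly_Mapping.lookup ?k x * segment ?k (x + 1) hi"
    by (rule segment_Cons) (use assms in simp)
  also have "segment ?k lo (x - 1) = 1"
    by (rule segment_eq_1) (simp add: lookup_single when_def)
  also have "segment ?k (x + 1) hi = 1"
    by (rule segment_eq_1) (simp add: lookup_single when_def)
  finally show ?thesis by (simp add: normal_order_single)
qed

text \<open>The recurrence at 0 gives X_(-1) = c q - X_1, so half the difference is X_1 - h c q,
  which is p by \<open>mode_1\<close>.\<close>

lemma half_mode_difference: "free_const (\<iota> (1 / 2)) * (mode 1 - mode (- 1)) = free_gen Gen_p"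
proof -
  let ?c = "free_const (\<iota> (\<alpha> + inverse \<alpha>))" and ?h = "free_const (\<iota> (1 / 2))"
  have "\<iota> (1 / 2) + \<iota> (1 / 2) = 1"
    using \<iota>_add[of "1 / 2" "1 / 2"] \<iota>_one by simp
  then have h: "?h + ?h = (1 :: 'r free_alg)" by (simp flip: single_add)
  have mode: "mode (- 1) = ?c * mode 0 - mode 1"
    using mode_Suc[of 0] by (simp add: algebra_simps)
  have "?h * (mode 1 - mode (- 1)) = (?h + ?h) * mode 1 - ?h * ?c * mode 0"
    unfolding mode by (simp add: algebra_simps)
  also have "\<dots> = free_gen Gen_p"
    by (simp add: h mode_0 mode_1 single_zero_mult)
  finally show ?thesis .
qed

lemma weyl_algebra_iso_observables:
  assumes I1: "spans I\<^sub>1 a\<^sub>1 b\<^sub>1" and I2: "spans I\<^sub>2 a\<^sub>2 b\<^sub>2" and "b\<^sub>1 < a\<^sub>2" and J: "spans J lo hi"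
    and "lo < 0" "0 < hi"
  shows "let A = obs_algebra \<iota> \<alpha> hbar I\<^sub>1 I\<^sub>2 J in
    defines_alg_iso ring_of_type_algebra (weyl_algebra hbar) A
      {(weyl_class hbar (free_gen Gen_q), H0_fun \<iota> \<alpha> hbar J (delta 0)),
       (weyl_class hbar (free_gen Gen_p),
          \<iota> (1 / 2) \<odot>\<^bsub>A\<^esub> H0_fun \<iota> \<alpha> hbar J (delta 1 - delta (- 1)))}"
proof -
  let ?W = "weyl_algebra hbar" and ?A = "obs_algebra \<iota> \<alpha> hbar I\<^sub>1 I\<^sub>2 J"
  let ?f = "obs_of_weyl lo hi"
  have add: "?f (C \<oplus>\<^bsub>?W\<^esub> D) = ?f C \<oplus>\<^bsub>?A\<^esub> ?f D" if C: "C \<in> carrier ?W" and D: "D \<in> carrier ?W" for C D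
  proof -
    have "H0_class \<iota> \<alpha> hbar J (sym_add F G) = ?f (C \<oplus>\<^bsub>?W\<^esub> D)"
      if F: "F \<in> ?f C" and G: "G \<in> ?f D" for F G
    proof -
      obtain f where f: "F = sym_even f" "f \<in> polys_in {lo..hi}" "C = weyl_class hbar (normal_order f)"
        using obs_of_weylE[OF F C] .
      obtain g where g: "G = sym_even g" "g \<in> polys_in {lo..hi}" "D = weyl_class hbar (normal_order g)"
        using obs_of_weylE[OF G D] .
      show ?thesis
        using f g H0_class_even[OF J polys_in_add[OF f(2) g(2)]]
        by (simp add: sym_add_even weyl_algebra_add normal_order_add)
    qed
    then show ?thesis
      using obs_of_weyl_nonempty[OF J C] obs_of_weyl_nonempty[OF J D]
      by (auto simp: obs_algebra_def)
  qed
  have smult: "?f (r \<odot>\<^bsub>?W\<^esub> C) = r \<odot>\<^bsub>?A\<^esub> ?f C" if C: "C \<in> carrier ?W" for r C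
  proof -
    have "H0_class \<iota> \<alpha> hbar J (sym_smult r F) = ?f (r \<odot>\<^bsub>?W\<^esub> C)" if F: "F \<in> ?f C" for F
    proof -
      obtain f where f: "F = sym_even f" "f \<in> polys_in {lo..hi}" "C = weyl_class hbar (normal_order f)"
        using obs_of_weylE[OF F C] .
      show ?thesis
        using f H0_class_even[OF J polys_in_mult[OF polys_in_const f(2)]]
        by (simp add: sym_smult_even weyl_algebra_smult normal_order_scale)
    qed
    then show ?thesis
      using obs_of_weyl_nonempty[OF J C] by (auto simp: obs_algebra_def)
  qed
  have mult: "?f (C \<otimes>\<^bsub>?W\<^esub> D) = ?f C \<otimes>\<^bsub>?A\<^esub> ?f D" if "C \<in> carrier ?W" "D \<in> carrier ?W" for C D
    using star_obs_of_weyl[OF assms(1-4) that] by (simp add: obs_algebra_def)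
  have one: "?f \<one>\<^bsub>?W\<^esub> = \<one>\<^bsub>?A\<^esub>"
    using H0_class_even[OF J, of 1] by (simp add: obs_algebra_def weyl_algebra_one normal_order_one)
  have zero: "?f \<zero>\<^bsub>?W\<^esub> = \<zero>\<^bsub>?A\<^esub>"
    using H0_class_even[OF J, of 0] by (simp add: obs_algebra_def weyl_algebra_zero sym_zero_eq)
  have carrier: "carrier ?A = ?f ` carrier ?W"
    by (simp add: obs_algebra_def H0_eq[OF J])
  have iso: "?f \<in> alg_iso ring_of_type_algebra ?W ?A"
    using inj_on_obs_of_weyl[OF J]
    by (auto simp: alg_iso_def alg_hom_def ring_hom_def bij_betw_def carrier add mult one smult)
  have linear: "H0_fun \<iota> \<alpha> hbar J g = ?f (weyl_class hbar (normal_order (ev_linear \<iota> J g)))" for g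
    unfolding H0_fun_def using J
    by (intro H0_class_even) (auto simp: ev_linear_def spans_def intro!: polys_in_sum polys_in_mult
        polys_in_var)
  have delta: "ev_linear \<iota> J (delta x) = ev_var x" if "lo \<le> x" "x \<le> hi" for x
    using that J by (intro ev_linear_delta) (auto simp: \<iota>_zero \<iota>_one spans_def)
  have q: "?f (weyl_class hbar (free_gen Gen_q)) = H0_fun \<iota> \<alpha> hbar J (delta 0)"
    using assms(5,6) by (simp only: linear delta[of 0] normal_order_var[of 0] mode_0 less_imp_le)
  have "\<iota> (1 / 2) \<odot>\<^bsub>?A\<^esub> H0_fun \<iota> \<alpha> hbar J (delta 1 - delta (- 1)) =
      ?f (\<iota> (1 / 2) \<odot>\<^bsub>?W\<^esub> weyl_class hbar (mode 1 - mode (- 1)))"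
    using assms
    by (simp add: linear delta ev_linear_diff[OF \<iota>_diff] normal_order_diff normal_order_var smult
        weyl_algebra_carrier)
  then have p: "?f (weyl_class hbar (free_gen Gen_p)) =
      \<iota> (1 / 2) \<odot>\<^bsub>?A\<^esub> H0_fun \<iota> \<alpha> hbar J (delta 1 - delta (- 1))"
    by (simp add: weyl_algebra_smult half_mode_difference)
  have "g C = ?f C"
    if g: "g \<in> alg_hom ring_of_type_algebra ?W ?A" and C: "C \<in> carrier ?W"
      and "g (weyl_class hbar (free_gen Gen_q)) = ?f (weyl_class hbar (free_gen Gen_q))"
      and "g (weyl_class hbar (free_gen Gen_p)) = ?f (weyl_class hbar (free_gen Gen_p))"
    for g C
  proof (rule weyl_algebra_hom_unique[OF g _ _ C])
    show "?f \<in> alg_hom ring_of_type_algebra ?W ?A" using iso by (simp add: alg_iso_def)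
    show "g (weyl_class hbar (free_gen a)) = ?f (weyl_class hbar (free_gen a))" for a
      using that by (cases a) auto
  qed
  then have "\<exists>f\<in>alg_iso ring_of_type_algebra ?W ?A.
      (\<forall>(x, y)\<in>{(weyl_class hbar (free_gen Gen_q), ?f (weyl_class hbar (free_gen Gen_q))),
        (weyl_class hbar (free_gen Gen_p), ?f (weyl_class hbar (free_gen Gen_p)))}. f x = y) \<and>
      (\<forall>g\<in>alg_hom ring_of_type_algebra ?W ?A.
        (\<forall>(x, y)\<in>{(weyl_class hbar (free_gen Gen_q), ?f (weyl_class hbar (free_gen Gen_q))),
          (weyl_class hbar (free_gen Gen_p), ?f (weyl_class hbar (free_gen Gen_p)))}. g x = y) \<longrightarrow>
        (\<forall>x\<in>carrier ?W. g x = f x))"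
    by (intro bexI[OF _ iso]) auto
  then show ?thesis
    unfolding Let_def defines_alg_iso_def p[symmetric] q[symmetric]
    using unital_algebra_weyl_algebra unital_algebra_alg_iso[OF _ iso zero] by blast
qed

end

text \<open>Open end points exclude integers equal to them, hence floor plus 1 and ceiling minus 1.
  Length above 2 leaves at least two integer points, enough for two neighbouring modes.\<close>

lemma interval_points:
  fixes I :: interval
  assumes "snd I - fst I > 2"
  obtains a b where "points I = {a..b}" "inner_points I = {a<..<b}" "a < b"
    "a = \<lfloor>fst I\<rfloor> + 1" "b = \<lceil>snd I\<rceil> - 1"
proof
  show "points I = {\<lfloor>fst I\<rfloor> + 1..\<lceil>snd I\<rceil> - 1}"
    by (auto simp: points_def simp flip: floor_less_iff less_ceiling_iff)
  have "fst I + 1 < of_int x \<longleftrightarrow> \<lfloor>fst I\<rfloor> + 1 < x" "of_int x < snd I - 1 \<longleftrightarrow> x < \<lceil>snd I\<rceil> - 1" for x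
    by linarith+
  then show "inner_points I = {\<lfloor>fst I\<rfloor> + 1<..<\<lceil>snd I\<rceil> - 1}"
    by (auto simp: inner_points_def points_def)
  show "\<lfloor>fst I\<rfloor> + 1 < \<lceil>snd I\<rceil> - 1" using assms by linarith
qed auto

lemma weyl_algebra_iso_observables_interval:
  fixes \<iota> :: "'k::field_char_0 \<Rightarrow> 'r::comm_ring_1"
    and I\<^sub>1 I\<^sub>2 J :: interval
  assumes "observables \<iota>"
    and "J = (-4, 4)"
    and "{fst I\<^sub>1<..<snd I\<^sub>1} \<subseteq> {fst J<..<snd J}" and "snd I\<^sub>1 - fst I\<^sub>1 > 2"
    and "{fst I\<^sub>2<..<snd I\<^sub>2} \<subseteq> {fst J<..<snd J}" and "snd I\<^sub>2 - fst I\<^sub>2 > 2"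
    and "snd I\<^sub>1 \<le> fst I\<^sub>2"
  shows "let A = obs_algebra \<iota> \<alpha> hbar I\<^sub>1 I\<^sub>2 J in
    defines_alg_iso ring_of_type_algebra (weyl_algebra hbar) A
      {(weyl_class hbar (free_gen Gen_q), H0_fun \<iota> \<alpha> hbar J (delta 0)),
       (weyl_class hbar (free_gen Gen_p),
          \<iota> (1 / 2) \<odot>\<^bsub>A\<^esub> H0_fun \<iota> \<alpha> hbar J (delta 1 - delta (- 1)))}"
proof -
  \<comment> \<open>An inclusion of open intervals bounds the end points only if the smaller one is
    nonempty, which its length ensures.\<close>
  have bounds: "- 4 \<le> fst I" "snd I \<le> 4"
    if "{fst I<..<snd I} \<subseteq> {fst J<..<snd J}" "snd I - fst I > 2" for I :: interval
    using that by (simp_all add: assms(2) greaterThanLessThan_subseteq_greaterThanLessThan)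
  obtain a\<^sub>1 b\<^sub>1 where I1: "points I\<^sub>1 = {a\<^sub>1..b\<^sub>1}" "inner_points I\<^sub>1 = {a\<^sub>1<..<b\<^sub>1}" "a\<^sub>1 < b\<^sub>1"
    "a\<^sub>1 = \<lfloor>fst I\<^sub>1\<rfloor> + 1" "b\<^sub>1 = \<lceil>snd I\<^sub>1\<rceil> - 1"
    using interval_points[OF assms(4)] .
  obtain a\<^sub>2 b\<^sub>2 where I2: "points I\<^sub>2 = {a\<^sub>2..b\<^sub>2}" "inner_points I\<^sub>2 = {a\<^sub>2<..<b\<^sub>2}" "a\<^sub>2 < b\<^sub>2"
    "a\<^sub>2 = \<lfloor>fst I\<^sub>2\<rfloor> + 1" "b\<^sub>2 = \<lceil>snd I\<^sub>2\<rceil> - 1"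
    using interval_points[OF assms(6)] .
  have J: "points J = {-3..3}" "inner_points J = {-3<..<3}"
    by (auto simp: assms(2) inner_points_def points_def)
  \<comment> \<open>The intervals may touch, but a common end point belongs to neither, so
    \<open>b\<^sub>1 < a\<^sub>2\<close> is strict.\<close>
  have ends: "- 3 \<le> a\<^sub>1" "b\<^sub>1 \<le> 3" "- 3 \<le> a\<^sub>2" "b\<^sub>2 \<le> 3" "b\<^sub>1 < a\<^sub>2"
    using bounds[OF assms(3,4)] bounds[OF assms(5,6)] assms(7) I1(4,5) I2(4,5) by linarith+
  interpret observables \<iota> \<alpha> hbar "-3" 3 by fact
  show ?thesis
    by (rule weyl_algebra_iso_observables[of I\<^sub>1 a\<^sub>1 b\<^sub>1 I\<^sub>2 a\<^sub>2 b\<^sub>2])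
      (use I1 I2 J ends in \<open>auto simp: spans_def\<close>)
qed

theorem mainTheorem3:
  fixes \<alpha> :: "'k::field_char_0"
    and I\<^sub>1 I\<^sub>2 J :: interval
  assumes "\<alpha> \<noteq> 0"
    and "J = (-4, 4)"
    and "{fst I\<^sub>1<..<snd I\<^sub>1} \<subseteq> {fst J<..<snd J}" and "snd I\<^sub>1 - fst I\<^sub>1 > 2"
    and "{fst I\<^sub>2<..<snd I\<^sub>2} \<subseteq> {fst J<..<snd J}" and "snd I\<^sub>2 - fst I\<^sub>2 > 2"
    and "snd I\<^sub>1 \<le> fst I\<^sub>2"
  shows
    "(\<forall>hbar::'k. hbar \<noteq> 0 \<longrightarrow>
       (let \<iota> = (\<lambda>c::'k. c);
            A = obs_algebra \<iota> \<alpha> hbar I\<^sub>1 I\<^sub>2 J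
        in defines_alg_iso ring_of_type_algebra (weyl_algebra hbar) A
             {(weyl_class hbar (free_gen Gen_q), H0_fun \<iota> \<alpha> hbar J (delta 0)),
              (weyl_class hbar (free_gen Gen_p),
                 \<iota> (1/2) \<odot>\<^bsub>A\<^esub> H0_fun \<iota> \<alpha> hbar J (delta 1 - delta (-1)))})) \<and>
     (let \<iota> = (\<lambda>c::'k. [:c:]); hbar = [:0, 1:];
          A = obs_algebra \<iota> \<alpha> hbar I\<^sub>1 I\<^sub>2 J
      in defines_alg_iso ring_of_type_algebra (weyl_algebra hbar) A
           {(weyl_class hbar (free_gen Gen_q), H0_fun \<iota> \<alpha> hbar J (delta 0)),
            (weyl_class hbar (free_gen Gen_p),
               \<iota> (1/2) \<odot>\<^bsub>A\<^esub> H0_fun \<iota> \<alpha> hbar J (delta 1 - delta (-1)))}) \<and>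
     (let \<iota> = (fps_const :: 'k \<Rightarrow> 'k fps); hbar = fps_X;
          A = obs_algebra \<iota> \<alpha> hbar I\<^sub>1 I\<^sub>2 J
      in defines_alg_iso ring_of_type_algebra (weyl_algebra hbar) A
           {(weyl_class hbar (free_gen Gen_q), H0_fun \<iota> \<alpha> hbar J (delta 0)),
            (weyl_class hbar (free_gen Gen_p),
               \<iota> (1/2) \<odot>\<^bsub>A\<^esub> H0_fun \<iota> \<alpha> hbar J (delta 1 - delta (-1)))})"
proof -
  \<comment> \<open>The structure map is the identity or the embedding of constants, in each case
    additive and unital; this covers the three rings of scalars.\<close>
  have id: "observables (\<lambda>c::'k. c)"
    and poly: "observables (\<lambda>c::'k. [:c:])"
    and fps: "observables (fps_const :: 'k \<Rightarrow> 'k fps)"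
    by unfold_locales auto
  note iso = weyl_algebra_iso_observables_interval[OF _ assms(2-7)]
  show ?thesis
    using iso[OF id] iso[OF poly] iso[OF fps] unfolding Let_def by blast
qed

end
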